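(* Let $r\ge 1$ be an integer and let $S:\mathbb{R}^{r+1}\to\mathbb{R}$ be a local potential satisfying conditions A, B and C, with Peierls barrier $P_\omega(\xi)$ ($\omega,\xi\in\mathbb{R}$). Let $L>0$. There exists a constant $C$ such that for all $\omega\in\mathbb{R}$ and all rationals $q/p\in\mathbb{Q}$ in lowest terms with $|\omega|\le L$ and $|q/p|\le L$, $$\left|P_\omega(\xi)-P_{q/p}(\xi)\right|\le C\left(\frac{1}{|p|}+|p\omega-q|\right)\quad\text{for all }\xi\in\mathbb{R},$$ where $C$ does not depend on $\xi$. Consequently, the map $\omega\mapsto P_\omega(\xi)$ is continuous at every irrational $\omega$ and Hölder continuous at every Diophantine $\omega$.
   Context: Conditions on $S:\mathbb{R}^{r+1}\to\mathbb{R}$, written as $S(x_0,\dots,x_r)$: A (periodicity): $S(x_0+1,\dots,x_r+1)=S(x_0,\dots,x_r)$ for all arguments. B (monotonicity): $S$ is $C^2$, $\partial_i\partial_k S\le 0$ everywhere for all $i\ne k$, and $\partial_0\partial_1 S<0$ everywhere. C (coercivity): $S$ is bounded from below and there is $k\in\{0,\dots,r-1\}$ such that $S(x_0,\dots,x_r)\to\infty$ as $|x_{k+1}-x_k|\to\infty$. For $p,q\in\mathbb{Z}$ with $p\ge1$ let $\mathbb{X}_{p,q}$ be the set of sequences $x:\mathbb{Z}\to\mathbb{R}$ with $x_{i-p}+q=x_i$ for all $i$, and for $x\in\mathbb{X}_{p,q}$ let $W_{p,q}(x)=\sum_{j=0}^{p-1}S(x_j,\dots,x_{j+r})$. For a rational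 $q/p$ in lowest terms (with $p\ge1$) and $\xi\in\mathbb{R}$, the Peierls barrier is $$P_{q/p}(\xi)=\min_{x\in\mathbb{X}_{p,q},\,x_0=\xi}W_{p,q}(x)-\min_{x\in\mathbb{X}_{p,q}}W_{p,q}(x).$$ For irrational $\omega$, $P_\omega(\xi)=\lim_{q/p\to\omega}P_{q/p}(\xi)$, the limit being over rationals converging to $\omega$ (this limit exists). A number $\omega\in\mathbb{R}$ is Diophantine if there are $\gamma>0$, $\tau\ge1$ with $|p\omega-q|\ge\gamma/|p|^\tau$ for all integers $p\ne0$ and $q$. A function $f:\mathbb{R}\to\mathbb{R}$ is Hölder continuous at $\omega$ if there are $c,\alpha,\delta>0$ with $|f(\omega)-f(\Omega)|\le c|\omega-\Omega|^\alpha$ whenever $|\omega-\Omega|\le\delta$. *)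

theory Defs
  imports "HOL-Analysis.Analysis"
begin

text \<open>
  A point of \<open>\<real>\<^sup>r\<^sup>+\<^sup>1\<close> is represented by a sequence \<open>x :: nat \<Rightarrow> real\<close> of which only the entries
  \<open>x 0, \<dots>, x r\<close> matter: functions on \<open>\<real>\<^sup>r\<^sup>+\<^sup>1\<close> are the functions on \<open>nat \<Rightarrow> real\<close> that depend
  on these entries only. For such a function, continuity in the product topology on
  \<open>nat \<Rightarrow> real\<close> is the same as continuity on \<open>\<real>\<^sup>r\<^sup>+\<^sup>1\<close>.
\<close>

definition local_potential :: "nat \<Rightarrow> ((nat \<Rightarrow> real) \<Rightarrow> real) \<Rightarrow> bool" where
  "local_potential r S \<longleftrightarrow> (\<forall>x y. (\<forall>i\<le>r. x i = y i) \<longrightarrow> S x = S y)"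

definition partial :: "nat \<Rightarrow> ((nat \<Rightarrow> real) \<Rightarrow> real) \<Rightarrow> (nat \<Rightarrow> real) \<Rightarrow> real" where
  "partial i f x = deriv (\<lambda>t. f (x(i := t))) (x i)"

definition C1_fun :: "nat \<Rightarrow> ((nat \<Rightarrow> real) \<Rightarrow> real) \<Rightarrow> bool" where
  "C1_fun r f \<longleftrightarrow> continuous_on UNIV f \<and>
     (\<forall>i\<le>r. (\<forall>x. (\<lambda>t. f (x(i := t))) differentiable (at (x i))) \<and>
             continuous_on UNIV (partial i f))"

definition C2_fun :: "nat \<Rightarrow> ((nat \<Rightarrow> real) \<Rightarrow> real) \<Rightarrow> bool" where
  "C2_fun r f \<longleftrightarrow> C1_fun r f \<and> (\<forall>i\<le>r. C1_fun r (partial i f))"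

definition cond_A :: "((nat \<Rightarrow> real) \<Rightarrow> real) \<Rightarrow> bool" where
  "cond_A S \<longleftrightarrow> (\<forall>x. S (\<lambda>i. x i + 1) = S x)"

definition cond_B :: "nat \<Rightarrow> ((nat \<Rightarrow> real) \<Rightarrow> real) \<Rightarrow> bool" where
  "cond_B r S \<longleftrightarrow> C2_fun r S \<and>
     (\<forall>i\<le>r. \<forall>k\<le>r. i \<noteq> k \<longrightarrow> (\<forall>x. partial i (partial k S) x \<le> 0)) \<and>
     (\<forall>x. partial 0 (partial 1 S) x < 0)"

definition cond_C :: "nat \<Rightarrow> ((nat \<Rightarrow> real) \<Rightarrow> real) \<Rightarrow> bool" where
  "cond_C r S \<longleftrightarrow> bdd_below (range S) \<and>
     (\<exists>k<r. filterlim S at_top (filtercomap (\<lambda>x. \<bar>x (k + 1) - x k\<bar>) at_top))"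

definition periodic_seqs :: "int \<Rightarrow> int \<Rightarrow> (int \<Rightarrow> real) set" where
  "periodic_seqs p q = {x. \<forall>i. x (i - p) + of_int q = x i}"

definition periodic_action ::
    "nat \<Rightarrow> ((nat \<Rightarrow> real) \<Rightarrow> real) \<Rightarrow> int \<Rightarrow> (int \<Rightarrow> real) \<Rightarrow> real" where
  "periodic_action r S p x = (\<Sum>j\<in>{0..p - 1}. S (\<lambda>i. x (j + int i)))"

text \<open>
  The minima below are taken over infinite sets, so they are written with
  \<open>LEAST\<close> (the least element of the set of values), not with \<open>Min\<close> or \<open>Inf\<close>.
\<close>

definition peierls_pq ::
    "nat \<Rightarrow> ((nat \<Rightarrow> real) \<Rightarrow> real) \<Rightarrow> int \<Rightarrow> int \<Rightarrow> real \<Rightarrow> real" where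
  "peierls_pq r S p q \<xi> =
     (LEAST w. w \<in> periodic_action r S p ` {x \<in> periodic_seqs p q. x 0 = \<xi>}) -
     (LEAST w. w \<in> periodic_action r S p ` periodic_seqs p q)"

text \<open>\<open>quotient_of s = (q, p)\<close> gives \<open>s = q / p\<close> in lowest terms with \<open>p > 0\<close>.\<close>

definition peierls_rat :: "nat \<Rightarrow> ((nat \<Rightarrow> real) \<Rightarrow> real) \<Rightarrow> rat \<Rightarrow> real \<Rightarrow> real" where
  "peierls_rat r S s \<xi> = (case quotient_of s of (q, p) \<Rightarrow> peierls_pq r S p q \<xi>)"

definition peierls :: "nat \<Rightarrow> ((nat \<Rightarrow> real) \<Rightarrow> real) \<Rightarrow> real \<Rightarrow> real \<Rightarrow> real" where
  "peierls r S \<omega> \<xi> =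
     (if \<omega> \<in> \<rat> then peierls_rat r S (THE s. of_rat s = \<omega>) \<xi>
      else Lim (filtercomap of_rat (nhds \<omega>)) (\<lambda>s. peierls_rat r S s \<xi>))"

lemma peierls_lowest_terms:
  assumes "p \<ge> 1" and "coprime p q"
  shows "peierls r S (of_int q / of_int p) \<xi> = peierls_pq r S p q \<xi>"
proof -
  have eq: "of_rat (Rat.Fract q p) = (of_int q / of_int p :: real)"
    using assms(1) by (simp add: of_rat_rat)
  have "quotient_of (Rat.Fract q p) = (q, p)"
    using assms by (simp add: quotient_of_Fract normalize_stable coprime_commute)
  moreover have "(THE s. of_rat s = (of_int q / of_int p :: real)) = Rat.Fract q p"
    unfolding eq[symmetric] by (rule the_equality) auto
  ultimately show ?thesis
    by (simp add: peierls_def peierls_rat_def)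
qed

definition diophantine :: "real \<Rightarrow> bool" where
  "diophantine \<omega> \<longleftrightarrow> (\<exists>\<gamma>>0. \<exists>\<tau>\<ge>1. \<forall>p q :: int. p \<noteq> 0 \<longrightarrow>
     \<bar>of_int p * \<omega> - of_int q\<bar> \<ge> \<gamma> / \<bar>of_int p\<bar> powr \<tau>)"

definition holder_continuous_at :: "(real \<Rightarrow> real) \<Rightarrow> real \<Rightarrow> bool" where
  "holder_continuous_at f \<omega> \<longleftrightarrow> (\<exists>c>0. \<exists>\<alpha>>0. \<exists>\<delta>>0. \<forall>\<Omega>. \<bar>\<omega> - \<Omega>\<bar> \<le> \<delta> \<longrightarrow>
     \<bar>f \<omega> - f \<Omega>\<bar> \<le> c * \<bar>\<omega> - \<Omega>\<bar> powr \<alpha>)"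

end

theory Submission
  imports Defs
begin

text \<open>
  Condition B makes \<open>S\<close> submodular, so the minimizers of \<open>W\<^bsub>p,q\<^esub>\<close> form a lattice that is invariant
  under translations. The maximum of finitely many translates of a minimizer is therefore again a
  minimizer; a suitable maximum is totally ordered with all its translates, \<open>x\<^sub>i = h (i Q)\<close> with \<open>h\<close>
  monotone and \<open>h (j + P) = h j + 1\<close>.

  Let \<open>\<epsilon> = \<bar>p Q / P - q\<bar>\<close> with \<open>p \<le> P\<close>, and let \<open>l \<le> u\<close> be consecutive translates of such a minimizer
  with \<open>l\<^sub>0 \<le> \<xi> \<le> u\<^sub>0\<close>. Over any \<open>p\<close> consecutive indices the gaps \<open>u\<^sub>i - l\<^sub>i\<close> sum up to at most \<open>1\<close>, and
  the drifts \<open>\<bar>l\<^sub>i + q - l\<^bsub>i+p\<^esub>\<bar>\<close> to at most \<open>1 + 2 p \<epsilon>\<close>. So some window of length \<open>p\<close> around the index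
  \<open>0\<close> has ends at which all of them are \<open>O(1/p + \<epsilon>)\<close>, which is the cost of cutting at these ends.
  A constrained minimizer of type \<open>(P, Q)\<close> is cut out along the window and closed up to type \<open>(p, q)\<close>;
  conversely, one of type \<open>(p, q)\<close> is truncated to lie between \<open>l\<close> and \<open>u\<close> and inserted into \<open>l\<close>.
  The two minimal actions are matched by the exact subadditivity of \<open>(p, q) \<mapsto> min W\<^bsub>p,q\<^esub>\<close>. The \<open>(P, Q)\<close>
  sequences are regarded as \<open>(2P, 2Q)\<close>-periodic, so that the complement of the window is not too short.
\<close>

section \<open>Submodularity and Lipschitz bounds\<close>

lemma partial_DERIV:
  assumes "C1_fun r f" "i \<le> r"
  shows "((\<lambda>t. f (x(i := t))) has_real_derivative partial i f (x(i := t))) (at t)"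
proof -
  have "(\<lambda>s. f ((x(i := t))(i := s))) differentiable (at ((x(i := t)) i))"
    using assms unfolding C1_fun_def by blast
  then have "(\<lambda>s. f (x(i := s))) differentiable (at t)"
    by simp
  then show ?thesis
    unfolding partial_def by (simp add: DERIV_deriv_iff_real_differentiable)
qed

text \<open>For \<open>x \<le> x'\<close> the straight path is replaced by one that moves a single coordinate at a time.\<close>

lemma increment_antimono:
  assumes loc: "local_potential r S" and B: "cond_B r S"
    and k: "k \<le> r" and le: "\<And>i. i \<le> r \<Longrightarrow> i \<noteq> k \<Longrightarrow> x i \<le> x' i" and bc: "b \<le> c"
  shows "S (x'(k := c)) - S (x'(k := b)) \<le> S (x(k := c)) - S (x(k := b))"
proof -
  have C2: "C1_fun r S" "\<And>i. i \<le> r \<Longrightarrow> C1_fun r (partial i S)"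
    using B by (auto simp: cond_B_def C2_fun_def)
  have neg: "\<And>i k x. i \<le> r \<Longrightarrow> k \<le> r \<Longrightarrow> i \<noteq> k \<Longrightarrow> partial i (partial k S) x \<le> 0"
    using B by (auto simp: cond_B_def)
  have step: "S (x(i := a', k := c)) - S (x(i := a', k := b)) \<le> S (x(i := a, k := c)) - S (x(i := a, k := b))"
    if "i \<le> r" "i \<noteq> k" "a \<le> a'" for i a a' x
  proof -
    have "partial k S (y(i := a')) \<le> partial k S (y(i := a))" for y
      by (rule DERIV_nonpos_imp_nonincreasing[OF that(3)])
         (use partial_DERIV[OF C2(2)[OF k] that(1)] neg[OF that(1) k that(2)] in blast)
    then have mono: "partial k S (x(i := a', k := t)) \<le> partial k S (x(i := a, k := t))" for t
      using that(2) by (metis fun_upd_twist)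
    have "S (x(i := a', k := c)) - S (x(i := a, k := c)) \<le> S (x(i := a', k := b)) - S (x(i := a, k := b))"
    proof (rule DERIV_nonpos_imp_nonincreasing[OF bc])
      fix t
      have "((\<lambda>t. S (x(i := a', k := t)) - S (x(i := a, k := t))) has_real_derivative
          partial k S (x(i := a', k := t)) - partial k S (x(i := a, k := t))) (at t)"
        by (intro DERIV_diff partial_DERIV[OF C2(1) k])
      then show "\<exists>y. ((\<lambda>t. S (x(i := a', k := t)) - S (x(i := a, k := t))) has_real_derivative y) (at t) \<and> y \<le> 0"
        using mono by (meson diff_le_0_iff_le)
    qed
    then show ?thesis by simp
  qed
  define m where "m n = (\<lambda>i. if i < n then x' i else x i)" for n :: nat
  have "S ((m n)(k := c)) - S ((m n)(k := b)) \<le> S (x(k := c)) - S (x(k := b))" if "n \<le> Suc r" for n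
    using that
  proof (induction n)
    case 0
    then show ?case by (simp add: m_def)
  next
    case (Suc n)
    show ?case
    proof (cases "n = k")
      \<comment> \<open>The coordinate \<open>k\<close> is overwritten by \<open>b\<close> or
        \<open>c\<close> anyway, so exchanging \<open>x k\<close> for \<open>x' k\<close> changes
        nothing.\<close>
      case True
      then have "(m (Suc n))(k := t) = (m n)(k := t)" for t
        by (auto simp: m_def fun_eq_iff)
      then show ?thesis using Suc by simp
    next
      case False
      have eq: "m (Suc n) = (m n)(n := x' n)" "m n = (m n)(n := x n)"
        by (auto simp: m_def fun_eq_iff)
      have "S ((m n)(n := x' n, k := c)) - S ((m n)(n := x' n, k := b))
          \<le> S ((m n)(n := x n, k := c)) - S ((m n)(n := x n, k := b))"
        by (rule step) (use False Suc.prems le in auto)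
      then have "S ((m (Suc n))(k := c)) - S ((m (Suc n))(k := b)) \<le> S ((m n)(k := c)) - S ((m n)(k := b))"
        by (simp only: eq(1) eq(2)[symmetric])
      then show ?thesis
        using Suc by linarith
    qed
  qed
  from this[of "Suc r"]
  have "S ((m (Suc r))(k := c)) - S ((m (Suc r))(k := b)) \<le> S (x(k := c)) - S (x(k := b))" by simp
  moreover have "S ((m (Suc r))(k := t)) = S (x'(k := t))" for t
    using loc unfolding local_potential_def by (auto simp: m_def)
  ultimately show ?thesis by simp
qed

text \<open>Raise \<open>y\<close> to the maximum and, in parallel, the minimum to \<open>x\<close>,
  one coordinate at a time. Both moves raise coordinate \<open>n\<close> from \<open>y n\<close> to
  \<open>x n\<close>, and only where \<open>y n < x n\<close>. By \<open>increment_antimono\<close>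
  the lower sequence gains at least as much as the upper one.\<close>

lemma submodular:
  assumes loc: "local_potential r S" and B: "cond_B r S"
  shows "S (\<lambda>i. min (x i) (y i)) + S (\<lambda>i. max (x i) (y i)) \<le> S x + S y"
proof -
  define a where "a n = (\<lambda>i. if i < n then max (x i) (y i) else y i)" for n :: nat
  define b where "b n = (\<lambda>i. if i < n then x i else min (x i) (y i))" for n :: nat
  have "S (a n) - S y \<le> S (b n) - S (b 0)" if "n \<le> Suc r" for n
    using that
  proof (induction n)
    case 0
    then show ?case by (simp add: a_def)
  next
    case (Suc n)
    show ?case
    proof (cases "x n \<le> y n")
      case True
      then have "a (Suc n) = a n" "b (Suc n) = b n"
        by (auto simp: a_def b_def fun_eq_iff less_Suc_eq)
      then show ?thesis using Suc by simp
    next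
      case False
      have eq: "a (Suc n) = (a n)(n := x n)" "a n = (a n)(n := y n)"
        "b (Suc n) = (b n)(n := x n)" "b n = (b n)(n := y n)"
        using False by (auto simp: a_def b_def fun_eq_iff less_Suc_eq)
      have "S ((a n)(n := x n)) - S ((a n)(n := y n)) \<le> S ((b n)(n := x n)) - S ((b n)(n := y n))"
        by (rule increment_antimono[OF loc B]) (use False Suc.prems in \<open>auto simp: a_def b_def\<close>)
      then have "S (a (Suc n)) - S (a n) \<le> S (b (Suc n)) - S (b n)"
        by (simp only: eq(1,3) eq(2,4)[symmetric])
      then show ?thesis
        using Suc by simp
    qed
  qed
  from this[of "Suc r"]
  have "S (a (Suc r)) - S y \<le> S (b (Suc r)) - S (b 0)" by simp
  moreover have "S (a (Suc r)) = S (\<lambda>i. max (x i) (y i))" "S (b (Suc r)) = S x"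
    using loc unfolding local_potential_def by (auto simp: a_def b_def)
  ultimately show ?thesis by (simp add: b_def)
qed

section \<open>Local Lipschitz bounds for the potential\<close>

lemma compact_PiE_real:
  fixes T :: "'a \<Rightarrow> real set"
  assumes "\<And>i. compact (T i)"
  shows "compact (PiE UNIV T)"
proof -
  have "compactin (product_topology (\<lambda>i. euclidean) UNIV) (PiE UNIV T)"
    using assms by (simp add: compactin_PiE)
  then show ?thesis by (simp add: euclidean_product_topology)
qed

lemma lipschitz_box:
  assumes loc: "local_potential r S" and C1: "C1_fun r S"
  obtains K where "K \<ge> 0" and "\<And>u v. (\<And>i. i \<le> r \<Longrightarrow> \<bar>u i\<bar> \<le> B) \<Longrightarrow> (\<And>i. i \<le> r \<Longrightarrow> \<bar>v i\<bar> \<le> B)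
      \<Longrightarrow> \<bar>S u - S v\<bar> \<le> K * (\<Sum>i\<le>r. \<bar>u i - v i\<bar>)"
proof -
  define T where "T = (\<lambda>i. if i \<le> r then {-B..B} else {0})"
  define Q where "Q = PiE UNIV T"
  have cQ: "compact Q"
    unfolding Q_def by (rule compact_PiE_real) (auto simp: T_def)
  have "\<exists>M. \<forall>x\<in>Q. \<bar>partial k S x\<bar> \<le> M" if "k \<le> r" for k
  proof -
    have "continuous_on Q (partial k S)"
      using C1 that continuous_on_subset unfolding C1_fun_def by blast
    then have "bounded (partial k S ` Q)"
      using cQ compact_continuous_image compact_imp_bounded by blast
    then show ?thesis by (auto simp: bounded_iff)
  qed
  then obtain M where M: "\<And>k x. k \<le> r \<Longrightarrow> x \<in> Q \<Longrightarrow> \<bar>partial k S x\<bar> \<le> M k" by metis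
  define K where "K = (\<Sum>k\<le>r. \<bar>M k\<bar>)"
  have MK: "\<bar>partial k S x\<bar> \<le> K" if "k \<le> r" "x \<in> Q" for k x
  proof -
    have "\<bar>M k\<bar> \<le> K" unfolding K_def by (rule member_le_sum) (use that in auto)
    then show ?thesis using M[OF that] by linarith
  qed
  have K0: "K \<ge> 0" by (simp add: K_def sum_nonneg)
  have main: "\<bar>S u - S v\<bar> \<le> K * (\<Sum>i\<le>r. \<bar>u i - v i\<bar>)" if uQ: "u \<in> Q" and vQ: "v \<in> Q" for u v
  proof -
    define m where "m n = (\<lambda>i. if i < n then v i else u i)" for n :: nat
    have mQ: "m n \<in> Q" for n
      using uQ vQ by (auto simp: Q_def PiE_iff m_def)
    have "\<bar>S u - S (m n)\<bar> \<le> K * (\<Sum>i<n. \<bar>u i - v i\<bar>)" if "n \<le> Suc r" for n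
      using that
    proof (induction n)
      case 0
      then show ?case by (simp add: m_def)
    next
      case (Suc n)
      then have n: "n \<le> r" by simp
      have eq: "m (Suc n) = (m n)(n := v n)" "m n = (m n)(n := u n)"
        by (auto simp: m_def fun_eq_iff)
      have inQ: "(m n)(n := t) \<in> Q" if "t \<in> {-B..B}" for t
        using mQ[of n] that n by (auto simp: Q_def PiE_iff) (auto simp: T_def)
      have rng: "u n \<in> {-B..B}" "v n \<in> {-B..B}"
        using uQ vQ n by (auto simp: Q_def T_def PiE_iff split: if_splits)
      have "norm (S ((m n)(n := u n)) - S ((m n)(n := v n))) \<le> K * norm (u n - v n)"
        by (rule field_differentiable_bound[where S="{-B..B}" and f="\<lambda>t. S ((m n)(n := t))"
              and f'="\<lambda>t. partial n S ((m n)(n := t))"])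
           (use rng partial_DERIV[OF C1 n] MK[OF n inQ] in \<open>auto intro: has_field_derivative_at_within\<close>)
      then have "\<bar>S (m n) - S (m (Suc n))\<bar> \<le> K * \<bar>u n - v n\<bar>"
        using eq by simp
      then show ?case
        using Suc by (simp add: distrib_left)
    qed
    from this[of "Suc r"] have "\<bar>S u - S (m (Suc r))\<bar> \<le> K * (\<Sum>i\<le>r. \<bar>u i - v i\<bar>)"
      by (simp add: lessThan_Suc_atMost)
    moreover have "S (m (Suc r)) = S v"
      using loc unfolding local_potential_def by (auto simp: m_def)
    ultimately show ?thesis by simp
  qed
  show thesis
  proof (rule that[OF K0])
    fix u v :: "nat \<Rightarrow> real"
    assume u: "\<And>i. i \<le> r \<Longrightarrow> \<bar>u i\<bar> \<le> B" and v: "\<And>i. i \<le> r \<Longrightarrow> \<bar>v i\<bar> \<le> B"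
    define u' where "u' = (\<lambda>i. if i \<le> r then u i else 0)"
    define v' where "v' = (\<lambda>i. if i \<le> r then v i else 0)"
    have "u' \<in> Q" "v' \<in> Q"
      using u v by (auto simp: Q_def T_def u'_def v'_def PiE_iff abs_le_iff minus_le_iff)
    then have "\<bar>S u' - S v'\<bar> \<le> K * (\<Sum>i\<le>r. \<bar>u' i - v' i\<bar>)" by (rule main)
    moreover have "S u' = S u" "S v' = S v"
      using loc unfolding local_potential_def by (auto simp: u'_def v'_def)
    ultimately show "\<bar>S u - S v\<bar> \<le> K * (\<Sum>i\<le>r. \<bar>u i - v i\<bar>)"
      by (simp add: u'_def v'_def)
  qed
qed

lemma cond_A_int:
  assumes "cond_A S"
  shows "S (\<lambda>i. x i + of_int m) = S x"
proof -
  have A: "\<And>x. S (\<lambda>i. x i + 1) = S x" using assms by (simp add: cond_A_def)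
  show ?thesis
  proof (induction m rule: int_induct[where k=0])
    case base
    then show ?case by simp
  next
    case (step1 i)
    then show ?case using A[of "\<lambda>k. x k + of_int i"] by (simp add: add.assoc)
  next
    case (step2 i)
    then show ?case using A[of "\<lambda>k. x k + of_int (i - 1)"] by simp
  qed
qed

text \<open>An integer translation, which leaves \<open>S\<close> unchanged by condition A, brings
  \<open>u 0\<close> into the unit interval. With steps at most \<open>D\<close> everything then
  lies in a box that depends on \<open>r\<close> and \<open>D\<close> only.\<close>

lemma lipschitz_bounded_steps:
  assumes loc: "local_potential r S" and C1: "C1_fun r S" and A: "cond_A S" and D: "D \<ge> 0"
  shows "\<exists>K\<ge>0. \<forall>u v. (\<forall>i<r. \<bar>u (Suc i) - u i\<bar> \<le> D) \<longrightarrow> (\<forall>i\<le>r. \<bar>u i - v i\<bar> \<le> D)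
      \<longrightarrow> \<bar>S u - S v\<bar> \<le> K * (\<Sum>i\<le>r. \<bar>u i - v i\<bar>)"
proof -
  \<comment> \<open>The translated \<open>u\<close> stays within \<open>1 + r * D\<close>, and
    \<open>v\<close> is at most \<open>D\<close> further out.\<close>
  define B where "B = 1 + (real r + 1) * D"
  obtain K where K0: "K \<ge> 0" and K: "\<And>u v. (\<And>i. i \<le> r \<Longrightarrow> \<bar>u i\<bar> \<le> B) \<Longrightarrow> (\<And>i. i \<le> r \<Longrightarrow> \<bar>v i\<bar> \<le> B)
      \<Longrightarrow> \<bar>S u - S v\<bar> \<le> K * (\<Sum>i\<le>r. \<bar>u i - v i\<bar>)"
    using lipschitz_box[OF loc C1] by blast
  have "\<bar>S u - S v\<bar> \<le> K * (\<Sum>i\<le>r. \<bar>u i - v i\<bar>)"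
    if st: "\<forall>i<r. \<bar>u (Suc i) - u i\<bar> \<le> D" and cl: "\<forall>i\<le>r. \<bar>u i - v i\<bar> \<le> D" for u v
  proof -
    define m where "m = - \<lfloor>u 0\<rfloor>"
    have b: "\<bar>u i + of_int m\<bar> \<le> 1 + real i * D" if "i \<le> r" for i
      using that
    proof (induction i)
      case 0
      then show ?case unfolding m_def by (simp, linarith)
    next
      case (Suc i)
      then have "\<bar>u (Suc i) - u i\<bar> \<le> D" "\<bar>u i + of_int m\<bar> \<le> 1 + real i * D" using st by auto
      then show ?case by (simp add: distrib_right)
    qed
    have bu: "\<bar>u i + of_int m\<bar> \<le> 1 + real r * D" if "i \<le> r" for i
      using b[OF that] mult_right_mono[OF _ D, of "real i" "real r"] that by simp
    have "\<bar>S (\<lambda>i. u i + of_int m) - S (\<lambda>i. v i + of_int m)\<bar>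
        \<le> K * (\<Sum>i\<le>r. \<bar>(u i + of_int m) - (v i + of_int m)\<bar>)"
    proof (rule K)
      fix i assume i: "i \<le> r"
      show "\<bar>u i + of_int m\<bar> \<le> B" using bu[OF i] D by (simp add: B_def distrib_right)
      show "\<bar>v i + of_int m\<bar> \<le> B" using bu[OF i] cl[rule_format, OF i] D
        by (simp add: B_def distrib_right)
    qed
    then show ?thesis by (simp add: cond_A_int[OF A])
  qed
  then show ?thesis using K0 by blast
qed

section \<open>Minimizers of the periodic action\<close>

lemma periodic_seqs_iff: "x \<in> periodic_seqs p q \<longleftrightarrow> (\<forall>i. x (i + p) = x i + of_int q)"
  unfolding periodic_seqs_def mem_Collect_eq by (metis add_diff_cancel diff_add_cancel)

lemma periodic_seqs_add: "x \<in> periodic_seqs p q \<Longrightarrow> x (i + p) = x i + of_int q"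
  by (simp add: periodic_seqs_iff)

lemma quasiperiodic_add_mult:
  fixes h :: "int \<Rightarrow> real"
  assumes "\<And>i. h (i + p) = h i + c"
  shows "h (i + n * p) = h i + of_int n * c"
proof (induction n rule: int_induct[where k=0])
  case base
  then show ?case by simp
next
  case (step1 n)
  then show ?case using assms[of "i + n * p"] by (simp add: algebra_simps)
next
  case (step2 n)
  then show ?case using assms[of "i + (n - 1) * p"] by (simp add: algebra_simps)
qed

lemma periodic_seqs_add_mult:
  "x \<in> periodic_seqs p q \<Longrightarrow> x (i + n * p) = x i + of_int n * of_int q"
  by (rule quasiperiodic_add_mult) (simp add: periodic_seqs_add)

lemma sum_period:
  fixes f :: "int \<Rightarrow> real"
  assumes "\<And>i. f (i + p) = f i" "p \<ge> 0"
  shows "sum f {a..<a + p} = sum f {0..<p}"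
proof -
  have step: "sum f {a + 1..<a + 1 + p} = sum f {a..<a + p}" for a
  proof (cases "p = 0")
    case False
    then have "{a..<a + p} = insert a {a + 1..<a + p}" "{a + 1..<a + 1 + p} = insert (a + p) {a + 1..<a + p}"
      using assms(2) by auto
    then show ?thesis using assms(1) by simp
  qed simp
  show ?thesis
  proof (induction a rule: int_induct[where k=0])
    case base
    then show ?case by simp
  next
    case (step1 a)
    then show ?case using step[of a] by simp
  next
    case (step2 a)
    then show ?case using step[of "a - 1"] by simp
  qed
qed

lemma sum_split:
  fixes f :: "int \<Rightarrow> real"
  assumes "a \<le> b" "b \<le> c"
  shows "sum f {a..<c} = sum f {a..<b} + sum f {b..<c}"
  using sum.union_disjoint[of "{a..<b}" "{b..<c}" f] assms by (simp add: ivl_disj_un ivl_disj_int)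

text \<open>This is closing up: only the values of \<open>u\<close> on \<open>{a..<a + p}\<close>
  enter. The price is paid after the end of the window, where \<open>u (i + p)\<close> is replaced
  by \<open>u i + q\<close>.\<close>

definition periodic_ext :: "int \<Rightarrow> int \<Rightarrow> int \<Rightarrow> (int \<Rightarrow> real) \<Rightarrow> int \<Rightarrow> real" where
  "periodic_ext a p q u i = u (a + (i - a) mod p) + of_int ((i - a) div p) * of_int q"

lemma periodic_ext_in: "p \<ge> 1 \<Longrightarrow> periodic_ext a p q u \<in> periodic_seqs p q"
proof -
  assume "p \<ge> 1"
  moreover have "i + p - a = (i - a) + p" for i by simp
  ultimately show ?thesis
    unfolding periodic_seqs_iff periodic_ext_def by (simp only: div_add_self2 mod_add_self2) (simp add: algebra_simps)
qed

lemma periodic_ext_eq: "a \<le> i \<Longrightarrow> i < a + p \<Longrightarrow> periodic_ext a p q u i = u i"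
  by (simp add: periodic_ext_def)

lemma periodic_ext_next:
  "p \<ge> 1 \<Longrightarrow> a \<le> i \<Longrightarrow> i < a + p \<Longrightarrow> periodic_ext a p q u (i + p) = u i + of_int q"
  using periodic_seqs_add[OF periodic_ext_in] periodic_ext_eq by simp

lemma periodic_ext_between:
  assumes "p \<ge> 1" "l \<in> periodic_seqs p q" "h \<in> periodic_seqs p q"
    and "\<And>i. a \<le> i \<Longrightarrow> i < a + p \<Longrightarrow> l i \<le> u i \<and> u i \<le> h i"
  shows "l i \<le> periodic_ext a p q u i \<and> periodic_ext a p q u i \<le> h i"
proof -
  let ?i = "a + (i - a) mod p" and ?n = "(i - a) div p"
  have "?i + ?n * p = i" by (simp add: algebra_simps)
  then have "l i = l ?i + of_int ?n * of_int q" "h i = h ?i + of_int ?n * of_int q"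
    using periodic_seqs_add_mult[OF assms(2), of ?i ?n] periodic_seqs_add_mult[OF assms(3), of ?i ?n] by simp_all
  then show ?thesis
    using assms(4)[of ?i] assms(1) by (simp add: periodic_ext_def)
qed

lemma periodic_seqs_shift:
  "x \<in> periodic_seqs p q \<Longrightarrow> (\<lambda>i. x (i + s) + of_int l) \<in> periodic_seqs p q"
  unfolding periodic_seqs_iff by (metis add.assoc add.commute)

lemma periodic_seqs_min:
  "x \<in> periodic_seqs p q \<Longrightarrow> y \<in> periodic_seqs p q \<Longrightarrow> (\<lambda>i. min (x i) (y i)) \<in> periodic_seqs p q"
  by (simp add: periodic_seqs_iff min_add_distrib_left)

lemma periodic_seqs_max:
  "x \<in> periodic_seqs p q \<Longrightarrow> y \<in> periodic_seqs p q \<Longrightarrow> (\<lambda>i. max (x i) (y i)) \<in> periodic_seqs p q"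
  by (simp add: periodic_seqs_iff max_add_distrib_left)

lemma periodic_seqs_linear:
  "p \<ge> 1 \<Longrightarrow> (\<lambda>i. c + of_int i * (of_int q / of_int p)) \<in> periodic_seqs p q"
  by (simp add: periodic_seqs_iff field_simps)

lemma periodic_seqs_mult: "x \<in> periodic_seqs p q \<Longrightarrow> x \<in> periodic_seqs (n * p) (n * q)"
  using periodic_seqs_add_mult[of x p q] by (simp add: periodic_seqs_iff)

lemma closed_periodic_seqs: "closed (periodic_seqs p q)"
proof -
  have "periodic_seqs p q = (\<Inter>i. {x. x (i - p) + of_int q = x i})"
    by (auto simp: periodic_seqs_def)
  moreover have "closed {x. x (i - p) + of_int q = (x i :: real)}" for i
    by (intro closed_Collect_eq continuous_intros continuous_on_product_coordinates)
  ultimately show ?thesis by auto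
qed

text \<open>All that is used of conditions A, B and C from here on. Derivatives survive only through
  submodularity and the Lipschitz bound, and \<open>coercive\<close> is condition C with sublevel
  sets in place of filters.\<close>

locale monotone_potential =
  fixes r :: nat and S :: "(nat \<Rightarrow> real) \<Rightarrow> real"
  assumes shift: "S (\<lambda>i. x i + of_int m) = S x"
    and cont: "continuous_on UNIV S"
    and submod: "S (\<lambda>i. min (x i) (y i)) + S (\<lambda>i. max (x i) (y i)) \<le> S x + S y"
    and lip: "D \<ge> 0 \<Longrightarrow> \<exists>K\<ge>0. \<forall>u v. (\<forall>i<r. \<bar>u (Suc i) - u i\<bar> \<le> D) \<longrightarrow> (\<forall>i\<le>r. \<bar>u i - v i\<bar> \<le> D)
      \<longrightarrow> \<bar>S u - S v\<bar> \<le> K * (\<Sum>i\<le>r. \<bar>u i - v i\<bar>)"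
    and bdd: "\<exists>b. \<forall>x. b \<le> S x"
    and coercive: "\<exists>k<r. \<forall>c. \<exists>R. \<forall>x. S x \<le> c \<longrightarrow> \<bar>x (Suc k) - x k\<bar> \<le> R"
begin

text \<open>Windows are half-open so that actions add up. The action on \<open>{a..<b}\<close>
  depends on \<open>x\<close> over \<open>{a..<b + int r}\<close>, hence every cut involves
  \<open>r\<close> sites beyond the end.\<close>

definition act :: "(int \<Rightarrow> real) \<Rightarrow> int \<Rightarrow> int \<Rightarrow> real" where
  "act x a b = (\<Sum>j\<in>{a..<b}. S (\<lambda>i. x (j + int i)))"

definition minimizer :: "int \<Rightarrow> int \<Rightarrow> (int \<Rightarrow> real) \<Rightarrow> bool" where
  "minimizer p q y \<longleftrightarrow> y \<in> periodic_seqs p q \<and> (\<forall>x\<in>periodic_seqs p q. act y 0 p \<le> act x 0 p)"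

definition wmin :: "int \<Rightarrow> int \<Rightarrow> real" where
  "wmin p q = (LEAST w. w \<in> periodic_action r S p ` periodic_seqs p q)"

lemma periodic_action_eq: "periodic_action r S p x = act x 0 p"
proof -
  have "{0..p - 1} = {0..<p}" by auto
  then show ?thesis by (simp add: periodic_action_def act_def)
qed

lemma wmin_eq: "minimizer p q y \<Longrightarrow> wmin p q = act y 0 p"
  unfolding wmin_def minimizer_def periodic_action_eq by (rule Least_equality) auto

lemma act_split: "a \<le> b \<Longrightarrow> b \<le> c \<Longrightarrow> act x a c = act x a b + act x b c"
  unfolding act_def by (rule sum_split)

lemma act_shift: "act (\<lambda>i. x (i + s) + of_int l) a b = act x (a + s) (b + s)"
proof -
  have "act (\<lambda>i. x (i + s) + of_int l) a b = (\<Sum>j\<in>{a..<b}. S (\<lambda>i. x ((j + s) + int i)))"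
    unfolding act_def
  proof (rule sum.cong[OF refl])
    fix j
    show "S (\<lambda>i. x (j + int i + s) + of_int l) = S (\<lambda>i. x ((j + s) + int i))"
      using shift[of "\<lambda>i. x ((j + s) + int i)" l] by (simp only: ac_simps)
  qed
  also have "\<dots> = act x (a + s) (b + s)"
    unfolding act_def by (rule sum.reindex_bij_witness[of _ "\<lambda>j. j - s" "\<lambda>j. j + s"]) auto
  finally show ?thesis .
qed

lemma act_window:
  assumes "x \<in> periodic_seqs p q" "p \<ge> 0"
  shows "act x a (a + p) = act x 0 p"
  unfolding act_def
proof (rule sum_period[OF _ assms(2)])
  fix i
  have "S (\<lambda>n. x (i + int n) + of_int q) = S (\<lambda>n. x (i + int n))" by (rule shift)
  moreover have "x (i + p + int n) = x (i + int n) + of_int q" for n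
    using periodic_seqs_add[OF assms(1), of "i + int n"] by (simp add: algebra_simps)
  ultimately show "S (\<lambda>n. x (i + p + int n)) = S (\<lambda>n. x (i + int n))" by simp
qed

lemma act_translate:
  assumes "x \<in> periodic_seqs p q" "p \<ge> 0"
  shows "act (\<lambda>i. x (i + s) + of_int l) 0 p = act x 0 p"
  unfolding act_shift using act_window[OF assms, of s] by (simp add: add.commute)

lemma act_mult:
  assumes "x \<in> periodic_seqs p q" "p \<ge> 0"
  shows "act x 0 (int n * p) = real n * act x 0 p"
proof (induction n)
  case 0
  then show ?case by (simp add: act_def)
next
  case (Suc n)
  have "act x 0 (int n * p + p) = act x 0 (int n * p) + act x (int n * p) (int n * p + p)"
    by (rule act_split) (use assms in auto)
  then show ?case using Suc act_window[OF assms, of "int n * p"] by (simp add: algebra_simps)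
qed

lemma act_submod:
  "act (\<lambda>i. min (x i) (y i)) a b + act (\<lambda>i. max (x i) (y i)) a b \<le> act x a b + act y a b"
  unfolding act_def sum.distrib[symmetric] by (rule sum_mono) (rule submod)

lemma continuous_act: "continuous_on A (\<lambda>x. act x a b)"
  unfolding act_def
proof (intro continuous_on_sum)
  fix j
  show "continuous_on A (\<lambda>x. S (\<lambda>i. x (j + int i)))"
    by (rule continuous_on_compose2[OF cont])
       (auto intro!: continuous_on_coordinatewise_then_product
         continuous_on_subset[OF continuous_on_product_coordinates])
qed

text \<open>The direct method. Condition C controls a single difference
  \<open>x (k + 1) - x k\<close>, but the shifted terms of the action over one period see all
  differences. An integer translation puts \<open>x 0\<close> into the unit interval, and the
  remaining sequences lie in a compact product of intervals.\<close>

lemma minimizer_exists: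
  assumes p: "p \<ge> 1"
  shows "\<exists>y. minimizer p q y"
proof -
  obtain k where k: "\<And>c. \<exists>R. \<forall>x. S x \<le> c \<longrightarrow> \<bar>x (Suc k) - x k\<bar> \<le> R"
    using coercive by blast
  obtain b where b: "\<And>x. b \<le> S x" using bdd by blast
  define x0 :: "int \<Rightarrow> real" where "x0 = (\<lambda>i. 0 + of_int i * (of_int q / of_int p))"
  have x0: "x0 \<in> periodic_seqs p q" unfolding x0_def by (rule periodic_seqs_linear[OF p])
  define c where "c = act x0 0 p"
  \<comment> \<open>All other terms of the action are at least \<open>- \<bar>b\<bar>\<close>, so
    each term of an action below \<open>c\<close> is at most
    \<open>c + p * \<bar>b\<bar>\<close>.\<close>
  obtain R where R: "\<And>x. S x \<le> c + of_int p * \<bar>b\<bar> \<Longrightarrow> \<bar>x (Suc k) - x k\<bar> \<le> R"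
    using k[of "c + of_int p * \<bar>b\<bar>"] by blast
  have steps: "\<bar>x (i + 1) - x i\<bar> \<le> R" if x: "x \<in> periodic_seqs p q" and le: "act x 0 p \<le> c" for x i
  proof -
    define j where "j = (i - int k) mod p"
    define n where "n = (i - int k) div p"
    have j: "0 \<le> j" "j < p" and i: "i = j + int k + n * p"
      using p by (auto simp: j_def n_def algebra_simps)
    let ?f = "\<lambda>j. S (\<lambda>i. x (j + int i))"
    have "sum (\<lambda>j. ?f j + \<bar>b\<bar>) {0..<p} = act x 0 p + of_int p * \<bar>b\<bar>"
      using p by (simp add: act_def sum.distrib)
    moreover have "?f j + \<bar>b\<bar> \<le> sum (\<lambda>j. ?f j + \<bar>b\<bar>) {0..<p}"
    proof (rule member_le_sum)
      show "0 \<le> ?f j + \<bar>b\<bar>" for j using b[of "\<lambda>i. x (j + int i)"] by linarith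
    qed (use j in auto)
    ultimately have "?f j \<le> c + of_int p * \<bar>b\<bar>" using le by linarith
    from R[OF this] have "\<bar>x (j + int k + 1) - x (j + int k)\<bar> \<le> R" by (simp add: algebra_simps)
    moreover have "x (i + 1) = x (j + int k + 1) + of_int n * of_int q" "x i = x (j + int k) + of_int n * of_int q"
      using periodic_seqs_add_mult[OF x, of "j + int k + 1" n] periodic_seqs_add_mult[OF x, of "j + int k" n]
      by (simp_all add: i algebra_simps)
    ultimately show ?thesis by simp
  qed
  \<comment> \<open>\<open>K\<close> contains an integer translate of every competitor with action
    at most \<open>c\<close>, although the action does not occur in its definition.\<close>
  define K where "K = periodic_seqs p q \<inter> (\<Inter>i. {x. \<bar>x (i + 1) - x i\<bar> \<le> R}) \<inter> {x. 0 \<le> x 0 \<and> x 0 \<le> 1}"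
  have cl: "closed K"
    unfolding K_def
    by (intro closed_Int closed_periodic_seqs closed_INT ballI closed_Collect_le closed_Collect_conj
        continuous_intros continuous_on_product_coordinates)
  have R0: "R \<ge> 0" using steps[OF x0, of 0] c_def by linarith
  have sub: "K \<subseteq> PiE UNIV (\<lambda>i. {- (1 + \<bar>of_int i\<bar> * R)..1 + \<bar>of_int i\<bar> * R})"
  proof
    fix x assume x: "x \<in> K"
    then have d: "\<bar>x (i + 1) - x i\<bar> \<le> R" and z: "0 \<le> x 0" "x 0 \<le> 1" for i
      by (auto simp: K_def)
    have "\<bar>x i\<bar> \<le> 1 + \<bar>of_int i\<bar> * R" for i
    proof (induction i rule: int_induct[where k=0])
      case base
      then show ?case using z by simp
    next
      case (step1 i)
      then show ?case using d[of i] by (simp add: distrib_right)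
    next
      case (step2 i)
      then have "\<bar>of_int (i - 1)\<bar> * R = \<bar>of_int i\<bar> * R + R" by (simp add: algebra_simps)
      then show ?case using step2 d[of "i - 1"] by (simp del: of_int_diff)
    qed
    then have "x i \<in> {- (1 + \<bar>of_int i\<bar> * R)..1 + \<bar>of_int i\<bar> * R}" for i
      unfolding atLeastAtMost_iff by (metis abs_le_D1 abs_le_D2 minus_le_iff)
    then show "x \<in> PiE UNIV (\<lambda>i. {- (1 + \<bar>of_int i\<bar> * R)..1 + \<bar>of_int i\<bar> * R})"
      by blast
  qed
  have "compact ((PiE UNIV (\<lambda>i. {- (1 + \<bar>of_int i\<bar> * R)..1 + \<bar>of_int i\<bar> * R})) \<inter> K)"
    by (intro compact_Int_closed[OF _ cl] compact_PiE_real compact_Icc)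
  then have cK: "compact K"
    using inf.absorb2[OF sub] by (rule back_subst)
  have "x0 \<in> K" using steps[OF x0] x0 by (simp add: K_def c_def) (simp add: x0_def)
  then obtain y where y: "y \<in> K" "\<And>x. x \<in> K \<Longrightarrow> act y 0 p \<le> act x 0 p"
    using continuous_attains_inf[OF cK _ continuous_act] by (metis empty_iff)
  have "act y 0 p \<le> act x 0 p" if x: "x \<in> periodic_seqs p q" for x
  proof (cases "act x 0 p \<le> c")
    case True
    define x' where "x' = (\<lambda>i. x (i + 0) + of_int (- \<lfloor>x 0\<rfloor>))"
    have x': "x' \<in> periodic_seqs p q" "act x' 0 p = act x 0 p"
      unfolding x'_def by (rule periodic_seqs_shift[OF x], rule act_translate[OF x]) (use p in simp)
    have "x' \<in> K"
      using steps[OF x'(1)] x' True by (simp add: K_def) (simp add: x'_def, linarith)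
    then show ?thesis using y(2) x'(2) by metis
  next
    case False
    then show ?thesis using y(2)[OF \<open>x0 \<in> K\<close>] by (simp add: c_def)
  qed
  then show ?thesis using y(1) unfolding minimizer_def K_def by blast
qed

lemma wmin_le: "x \<in> periodic_seqs p q \<Longrightarrow> p \<ge> 1 \<Longrightarrow> wmin p q \<le> act x 0 p"
  using minimizer_exists wmin_eq minimizer_def by metis

text \<open>The minimum of \<open>x\<close> and \<open>y\<close> is a competitor, so its action is
  at least that of \<open>x\<close>; submodularity leaves at most the action of \<open>y\<close> for
  the maximum.\<close>

lemma minimizer_max:
  assumes "minimizer p q x" "minimizer p q y"
  shows "minimizer p q (\<lambda>i. max (x i) (y i))"
proof -
  have x: "x \<in> periodic_seqs p q" "\<And>z. z \<in> periodic_seqs p q \<Longrightarrow> act x 0 p \<le> act z 0 p"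
    and y: "y \<in> periodic_seqs p q" "\<And>z. z \<in> periodic_seqs p q \<Longrightarrow> act y 0 p \<le> act z 0 p"
    using assms by (auto simp: minimizer_def)
  have "act (\<lambda>i. max (x i) (y i)) 0 p \<le> act y 0 p"
    using x(2)[OF periodic_seqs_min[OF x(1) y(1)]] act_submod[of x y 0 p] by linarith
  then show ?thesis
    using periodic_seqs_max[OF x(1) y(1)] y(2) unfolding minimizer_def by (meson order_trans)
qed

lemma minimizer_translate:
  "minimizer p q x \<Longrightarrow> p \<ge> 0 \<Longrightarrow> minimizer p q (\<lambda>i. x (i + s) + of_int l)"
  unfolding minimizer_def using periodic_seqs_shift act_translate by auto

lemma minimizer_Max:
  assumes "finite J" "J \<noteq> {}" "\<And>j. j \<in> J \<Longrightarrow> minimizer p q (f j)"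
  shows "minimizer p q (\<lambda>i. Max ((\<lambda>j. f j i) ` J))"
  using assms
proof (induction J rule: finite_ne_induct)
  case (singleton x)
  then show ?case by simp
next
  case (insert x F)
  then have "minimizer p q (\<lambda>i. max (f x i) (Max ((\<lambda>j. f j i) ` F)))"
    by (intro minimizer_max) auto
  then show ?case using insert by simp
qed

text \<open>Minimizing over a multiple of the period gains nothing. The maximum of \<open>n\<close>
  translates of a long minimizer by multiples of \<open>(p, q)\<close> is a long minimizer that is
  already of type \<open>(p, q)\<close>, so its action is \<open>n\<close> times that of a
  competitor of \<open>y\<close>.\<close>

lemma minimizer_mult:
  assumes y: "minimizer p q y" and p: "p \<ge> 1" and n: "n \<ge> 1"
  shows "minimizer (int n * p) (int n * q) y"
proof -
  have np: "int n * p \<ge> 1" using p n by (smt (verit) mult_le_cancel_left1 of_nat_1 of_nat_le_iff)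
  obtain x where x: "minimizer (int n * p) (int n * q) x" using minimizer_exists[OF np] by blast
  define f where "f j = (\<lambda>i. x (i + int j * p) + of_int (- int j * q))" for j :: nat
  define z where "z = (\<lambda>i. Max ((\<lambda>j. f j i) ` {..<n}))"
  have z: "minimizer (int n * p) (int n * q) z"
    unfolding z_def f_def by (intro minimizer_Max minimizer_translate x) (use n np in \<open>auto simp: lessThan_empty_iff\<close>)
  have "z (i + p) = z i + of_int q" for i
  proof -
    \<comment> \<open>After \<open>n\<close> translations by \<open>(p, q)\<close> the sequence is
      back, so one more translation permutes the family cyclically.\<close>
    have "f n i = f 0 i"
      using x periodic_seqs_add[of x "int n * p" "int n * q" i] by (simp add: minimizer_def f_def)
    then have "(\<lambda>j. f (Suc j) i) ` {..<n} = (\<lambda>j. f j i) ` {..<n}"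
    proof (intro equalityI subsetI; elim imageE)
      fix t j assume "f n i = f 0 i" "t = f (Suc j) i" "j \<in> {..<n}"
      then show "t \<in> (\<lambda>j. f j i) ` {..<n}" using n by (cases "Suc j = n") auto
    next
      fix t j assume "f n i = f 0 i" "t = f j i" "j \<in> {..<n}"
      then show "t \<in> (\<lambda>j. f (Suc j) i) ` {..<n}" using n
        by (cases j) (auto intro: image_eqI[where x="n - 1"])
    qed
    moreover have "f j (i + p) = f (Suc j) i + of_int q" for j
      by (simp add: f_def algebra_simps)
    ultimately show ?thesis
      using Max_add_commute[of "{..<n}" "\<lambda>j. f (Suc j) i" "of_int q"] n by (simp add: z_def lessThan_empty_iff)
  qed
  then have zp: "z \<in> periodic_seqs p q" by (simp add: periodic_seqs_iff)
  have "act y 0 (int n * p) \<le> act z 0 (int n * p)"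
    using y zp p unfolding minimizer_def by (auto simp: act_mult[of _ p q] intro: mult_left_mono)
  then show ?thesis
    using z y periodic_seqs_mult[of y p q "int n"] unfolding minimizer_def by (auto intro: order_trans)
qed

lemma wmin_mult: "p \<ge> 1 \<Longrightarrow> n \<ge> 1 \<Longrightarrow> wmin (int n * p) (int n * q) = real n * wmin p q"
proof -
  assume p: "p \<ge> 1" and n: "n \<ge> 1"
  obtain y where y: "minimizer p q y" using minimizer_exists[OF p] by blast
  then have "act y 0 (int n * p) = real n * act y 0 p"
    using p by (intro act_mult[of _ p q]) (auto simp: minimizer_def)
  then show ?thesis
    using wmin_eq[OF y] wmin_eq[OF minimizer_mult[OF y p n]] by simp
qed

end

section \<open>Birkhoff minimizers and subadditivity of the minimal action\<close>

lemma mono_int_stepI: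
  fixes h :: "int \<Rightarrow> real"
  assumes "\<And>i. h i \<le> h (i + 1)" "i \<le> j"
  shows "h i \<le> h j"
  using assms(2)
proof (induction j rule: int_ge_induct)
  case base
  then show ?case by simp
next
  case (step j)
  then show ?case using assms(1)[of j] by linarith
qed

lemma sum_shift_int:
  fixes f :: "int \<Rightarrow> real"
  shows "(\<Sum>i\<in>{a + s..<b + s}. f i) = (\<Sum>i\<in>{a..<b}. f (i + s))"
  by (rule sum.reindex_bij_witness[of _ "\<lambda>j. j + s" "\<lambda>j. j - s"]) auto

lemma periodic_seqs_bounded_steps:
  assumes x: "x \<in> periodic_seqs p q" and p: "p \<ge> 1"
  shows "\<exists>D\<ge>0. \<forall>i. \<bar>x (i + 1) - x i\<bar> \<le> D"
proof -
  let ?D = "\<Sum>j\<in>{0..<p}. \<bar>x (j + 1) - x j\<bar>"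
  have "\<bar>x (i + 1) - x i\<bar> \<le> ?D" for i
  proof -
    have "x (i mod p + (i div p) * p) = x (i mod p) + of_int (i div p) * of_int q"
      "x (i mod p + 1 + (i div p) * p) = x (i mod p + 1) + of_int (i div p) * of_int q"
      by (rule periodic_seqs_add_mult[OF x])+
    moreover have "i mod p + (i div p) * p = i" "i mod p + 1 + (i div p) * p = i + 1" by simp_all
    ultimately have "x (i + 1) - x i = x (i mod p + 1) - x (i mod p)" by simp
    moreover have "\<bar>x (i mod p + 1) - x (i mod p)\<bar> \<le> ?D"
      by (rule member_le_sum) (use p in auto)
    ultimately show ?thesis by simp
  qed
  then show ?thesis by (meson abs_ge_zero order_trans)
qed

context monotone_potential
begin

text \<open>The finite maximum is the supremum over all \<open>T\<^sup>j x\<close>, \<open>j \<le> 0\<close>, where \<open>T\<close> is the minimal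
  translation (Bezout), since \<open>T\<^sup>P x = x + 1\<close>; hence it lies below its own image under \<open>T\<close>.\<close>

lemma birkhoff_minimizer:
  assumes P: "P \<ge> 1" and cop: "coprime P Q"
  shows "\<exists>h. (\<forall>i. h i \<le> h (i + 1)) \<and> (\<forall>i. h (i + P) = h i + 1) \<and>
    (\<forall>j. minimizer P Q (\<lambda>i. h (i * Q + j)))"
proof -
  \<comment> \<open>\<open>T\<close> shifts the index by \<open>i0\<close> and adds
    \<open>l0\<close>; on sequences of type \<open>(P, Q)\<close> its \<open>P\<close>-th power adds
    \<open>i0 * Q + l0 * P = 1\<close>.\<close>
  obtain i0 l0 where bez: "i0 * Q + l0 * P = 1"
    using bezout_int[of Q P] cop by (auto simp: gcd.commute coprime_iff_gcd_eq_1)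
  obtain x where x: "minimizer P Q x" using minimizer_exists[OF P] by blast
  then have xp: "x \<in> periodic_seqs P Q" by (simp add: minimizer_def)
  define f where "f j = (\<lambda>i. x (i + - j * i0) + of_int (- j * l0))" for j
  define y where "y = (\<lambda>i. Max ((\<lambda>j. f j i) ` {0..<P}))"
  have y: "minimizer P Q y"
    unfolding y_def f_def by (intro minimizer_Max minimizer_translate x) (use P in auto)
  then have yp: "y \<in> periodic_seqs P Q" by (simp add: minimizer_def)
  have f_le: "f j i \<le> y i" if "0 \<le> j" "j < P" for i j
    unfolding y_def using that by (intro Max_ge) auto
  have up: "y i \<le> y (i + i0) + of_int l0" for i
  proof -
    have "f j i \<le> y (i + i0) + of_int l0" if j: "0 \<le> j" "j < P" for j
    proof (cases "j = P - 1")
      \<comment> \<open>The family wraps around here: by Bezout \<open>f P\<close> is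
        \<open>f 0 - 1\<close>, which lies below \<open>f 0\<close>.\<close>
      case True
      have "i + - j * i0 = (i + i0) + (- i0) * P" by (simp add: True algebra_simps)
      then have "f j i = x ((i + i0) + (- i0) * P) + of_int (- j * l0)" by (simp only: f_def)
      also have "\<dots> = x (i + i0) + of_int (- i0) * of_int Q + of_int (- j * l0)"
        by (simp only: periodic_seqs_add_mult[OF xp])
      also have "\<dots> = x (i + i0) + of_int l0 - of_int (i0 * Q + l0 * P)" by (simp add: True algebra_simps)
      also have "\<dots> = f 0 (i + i0) + of_int l0 - 1" by (simp add: bez f_def)
      finally show ?thesis using f_le[of 0 "i + i0"] P by simp
    next
      case False
      have "f j i = f (j + 1) (i + i0) + of_int l0" by (simp add: f_def algebra_simps)
      then show ?thesis using f_le[of "j + 1" "i + i0"] j False by simp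
    qed
    then show ?thesis unfolding y_def using P by (subst Max_le_iff) (auto simp: y_def)
  qed
  \<comment> \<open>\<open>h j\<close> is the value at the index 0 of the \<open>j\<close>-th
    translate of \<open>y\<close>. That \<open>y\<close> lies below its image under \<open>T\<close>
    becomes monotonicity of \<open>h\<close>.\<close>
  define h where "h j = y (j * i0) + of_int (j * l0)" for j
  have "h i \<le> h (i + 1)" for i
    using up[of "i * i0"] by (simp add: h_def algebra_simps)
  moreover have "h (i + P) = h i + 1" for i
  proof -
    have "h (i + P) = y (i * i0 + i0 * P) + of_int (i * l0 + l0 * P)" by (simp add: h_def algebra_simps)
    also have "\<dots> = y (i * i0) + of_int (i * l0) + of_int (i0 * Q + l0 * P)"
      by (simp add: periodic_seqs_add_mult[OF yp])
    finally show ?thesis by (simp add: bez h_def)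
  qed
  moreover have "minimizer P Q (\<lambda>i. h (i * Q + j))" for j
  proof -
    \<comment> \<open>Writing \<open>i\<close> as \<open>i * (i0 * Q + l0 * P)\<close> identifies
      this sequence in \<open>i\<close> with the \<open>j\<close>-th translate of
      \<open>y\<close>.\<close>
    have eq: "h (i * Q + j) = y (i + j * i0) + of_int (j * l0)" for i
    proof -
      have "(i * Q + j) * i0 = i * (i0 * Q + l0 * P) + j * i0 + (- i * l0) * P"
        by (simp add: algebra_simps)
      then have "y ((i * Q + j) * i0) = y (i + j * i0 + (- i * l0) * P)" by (simp add: bez)
      also have "\<dots> = y (i + j * i0) - of_int (i * l0) * of_int Q"
        using periodic_seqs_add_mult[OF yp, of "i + j * i0" "- i * l0"] by simp
      finally show ?thesis by (simp add: h_def algebra_simps)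
    qed
    show ?thesis unfolding eq by (rule minimizer_translate[OF y]) (use P in simp)
  qed
  ultimately show ?thesis by blast
qed

section \<open>Cost of changing a sequence and of closing it up\<close>

definition lip_const :: "real \<Rightarrow> real \<Rightarrow> bool" where
  "lip_const D K \<longleftrightarrow> K \<ge> 0 \<and> (\<forall>u v a b. a \<le> b \<longrightarrow> (\<forall>i. \<bar>u (i + 1) - u i\<bar> \<le> D) \<longrightarrow>
     (\<forall>i. a \<le> i \<longrightarrow> i < b + int r \<longrightarrow> \<bar>u i - v i\<bar> \<le> D) \<longrightarrow>
     \<bar>act u a b - act v a b\<bar> \<le> K * (\<Sum>i\<in>{a..<b + int r}. \<bar>u i - v i\<bar>))"

text \<open>Each site belongs to at most \<open>r + 1\<close> of the arguments of \<open>S\<close>,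
  hence the factor \<open>r + 1\<close>. The constant does not depend on the window, so a change of
  small total size is cheap on windows of any length.\<close>

lemma lip_const_exists:
  assumes D: "D \<ge> 0"
  shows "\<exists>K. lip_const D K"
proof -
  obtain K where K0: "K \<ge> 0" and K: "\<And>u v. (\<forall>i<r. \<bar>u (Suc i) - u i\<bar> \<le> D) \<Longrightarrow> (\<forall>i\<le>r. \<bar>u i - v i\<bar> \<le> D)
      \<Longrightarrow> \<bar>S u - S v\<bar> \<le> K * (\<Sum>i\<le>r. \<bar>u i - v i\<bar>)"
    using lip[OF D] by blast
  have "\<bar>act u a b - act v a b\<bar> \<le> K * (real r + 1) * (\<Sum>i\<in>{a..<b + int r}. \<bar>u i - v i\<bar>)"
    if ab: "a \<le> b" and st: "\<forall>i. \<bar>u (i + 1) - u i\<bar> \<le> D"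
      and cl: "\<forall>i. a \<le> i \<longrightarrow> i < b + int r \<longrightarrow> \<bar>u i - v i\<bar> \<le> D" for u v a b
  proof -
    let ?d = "\<lambda>i. \<bar>u i - v i\<bar>"
    have "\<bar>act u a b - act v a b\<bar> \<le> (\<Sum>j\<in>{a..<b}. \<bar>S (\<lambda>i. u (j + int i)) - S (\<lambda>i. v (j + int i))\<bar>)"
      unfolding act_def sum_subtractf[symmetric] by (rule sum_abs)
    also have "\<dots> \<le> (\<Sum>j\<in>{a..<b}. K * (\<Sum>i\<le>r. ?d (j + int i)))"
    proof (rule sum_mono, rule K)
      fix j assume j: "j \<in> {a..<b}"
      show "\<forall>i<r. \<bar>u (j + int (Suc i)) - u (j + int i)\<bar> \<le> D"
      proof (intro allI impI)
        fix i
        show "\<bar>u (j + int (Suc i)) - u (j + int i)\<bar> \<le> D"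
          using st[rule_format, of "j + int i"] by (simp add: add.commute add.left_commute)
      qed
      show "\<forall>i\<le>r. \<bar>u (j + int i) - v (j + int i)\<bar> \<le> D"
        using cl j by auto
    qed
    also have "\<dots> = K * (\<Sum>i\<le>r. \<Sum>j\<in>{a..<b}. ?d (j + int i))"
      by (subst sum.swap) (simp add: sum_distrib_left)
    also have "\<dots> \<le> K * (\<Sum>i\<le>r. \<Sum>j\<in>{a..<b + int r}. ?d j)"
    proof (intro mult_left_mono K0 sum_mono)
      fix i assume i: "i \<in> {..r}"
      have "(\<Sum>j\<in>{a..<b}. ?d (j + int i)) = (\<Sum>j\<in>{a + int i..<b + int i}. ?d j)"
        by (rule sum.reindex_bij_witness[of _ "\<lambda>j. j - int i" "\<lambda>j. j + int i"]) auto
      also have "\<dots> \<le> (\<Sum>j\<in>{a..<b + int r}. ?d j)"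
        by (rule sum_mono2) (use i in auto)
      finally show "(\<Sum>j\<in>{a..<b}. ?d (j + int i)) \<le> (\<Sum>j\<in>{a..<b + int r}. ?d j)" .
    qed
    finally show ?thesis by (simp add: algebra_simps)
  qed
  moreover have "K * (real r + 1) \<ge> 0" using K0 by simp
  ultimately show ?thesis unfolding lip_const_def by blast
qed

lemma lip_const_nonneg: "lip_const D K \<Longrightarrow> K \<ge> 0"
  by (simp add: lip_const_def)

lemma act_lip:
  assumes "lip_const D K" "a \<le> b" "\<And>i. \<bar>u (i + 1) - u i\<bar> \<le> D"
    and "\<And>i. a \<le> i \<Longrightarrow> i < b + int r \<Longrightarrow> \<bar>u i - v i\<bar> \<le> D"
  shows "\<bar>act u a b - act v a b\<bar> \<le> K * (\<Sum>i\<in>{a..<b + int r}. \<bar>u i - v i\<bar>)"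
  using assms unfolding lip_const_def by blast

text \<open>Where \<open>u\<close> and \<open>v\<close> agree there is no cost; what remains are the
  \<open>r\<close> sites after \<open>b\<close>, seen by the arguments that overhang the end of the
  window.\<close>

lemma act_lip_tail:
  assumes lip: "lip_const D K" and ab: "a \<le> b" and st: "\<And>i. \<bar>u (i + 1) - u i\<bar> \<le> D"
    and eq: "\<And>i. a \<le> i \<Longrightarrow> i < b \<Longrightarrow> u i = v i"
    and cl: "\<And>i. b \<le> i \<Longrightarrow> i < b + int r \<Longrightarrow> \<bar>u i - v i\<bar> \<le> D"
  shows "\<bar>act u a b - act v a b\<bar> \<le> K * (\<Sum>i\<in>{b..<b + int r}. \<bar>u i - v i\<bar>)"
proof -
  have "D \<ge> 0" using st[of 0] by linarith
  then have "\<bar>act u a b - act v a b\<bar> \<le> K * (\<Sum>i\<in>{a..<b + int r}. \<bar>u i - v i\<bar>)"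
  proof (intro act_lip[OF lip ab])
    show "\<bar>u (i + 1) - u i\<bar> \<le> D" for i by (rule st)
    show "\<bar>u i - v i\<bar> \<le> D" if "a \<le> i" "i < b + int r" for i
      using eq[of i] cl[of i] that \<open>D \<ge> 0\<close> by (cases "i < b") auto
  qed
  moreover have "(\<Sum>i\<in>{a..<b + int r}. \<bar>u i - v i\<bar>) = (\<Sum>i\<in>{a..<b}. \<bar>u i - v i\<bar>) + (\<Sum>i\<in>{b..<b + int r}. \<bar>u i - v i\<bar>)"
    by (rule sum_split) (use ab in auto)
  moreover have "(\<Sum>i\<in>{a..<b}. \<bar>u i - v i\<bar>) = 0"
    by (rule sum.neutral) (use eq in auto)
  ultimately show ?thesis by simp
qed

text \<open>On the window nothing changes. On the \<open>r\<close> sites after it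
  \<open>u (i + p)\<close> is replaced by \<open>u i + q\<close>; since \<open>r \<le> p\<close>,
  these sites lie within the next period.\<close>

lemma periodic_closing:
  assumes lip: "lip_const D K" and p: "p \<ge> 1" "p \<ge> int r" and st: "\<And>i. \<bar>u (i + 1) - u i\<bar> \<le> D"
    and cl: "\<And>i. a \<le> i \<Longrightarrow> i < a + int r \<Longrightarrow> \<bar>u i + of_int q - u (i + p)\<bar> \<le> D"
  shows "act (periodic_ext a p q u) 0 p \<le> act u a (a + p) + K * (\<Sum>i\<in>{a..<a + int r}. \<bar>u i + of_int q - u (i + p)\<bar>)"
proof -
  let ?z = "periodic_ext a p q u"
  have nx: "\<bar>u (i + p) - ?z (i + p)\<bar> = \<bar>u i + of_int q - u (i + p)\<bar>" if "a \<le> i" "i < a + int r" for i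
    using periodic_ext_next[of p a i q u] that p by simp
  have "\<bar>act u a (a + p) - act ?z a (a + p)\<bar> \<le> K * (\<Sum>i\<in>{a + p..<a + p + int r}. \<bar>u i - ?z i\<bar>)"
  proof (rule act_lip_tail[OF lip])
    fix i assume "a + p \<le> i" "i < a + p + int r"
    then show "\<bar>u i - ?z i\<bar> \<le> D" using nx[of "i - p"] cl[of "i - p"] by simp
  qed (use p st periodic_ext_eq in auto)
  also have "(\<Sum>i\<in>{a + p..<a + p + int r}. \<bar>u i - ?z i\<bar>) = (\<Sum>i\<in>{a..<a + int r}. \<bar>u (i + p) - ?z (i + p)\<bar>)"
    using sum_shift_int[of "\<lambda>i. \<bar>u i - ?z i\<bar>" a p "a + int r"] by (simp add: add.commute add.left_commute)
  also have "\<dots> = (\<Sum>i\<in>{a..<a + int r}. \<bar>u i + of_int q - u (i + p)\<bar>)"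
    by (rule sum.cong) (use nx in auto)
  also have "act ?z a (a + p) = act ?z 0 p"
    by (rule act_window[OF periodic_ext_in]) (use p in auto)
  finally show ?thesis by linarith
qed

text \<open>Gluing \<open>n\<close> periods of one minimizer to \<open>n\<close> periods of the other costs an amount that does not
  depend on \<open>n\<close>; divide by \<open>n\<close>.\<close>

lemma wmin_subadditive:
  assumes p: "p1 \<ge> 1" "p2 \<ge> 1"
  shows "wmin (p1 + p2) (q1 + q2) \<le> wmin p1 q1 + wmin p2 q2"
proof -
  obtain y where y: "minimizer p1 q1 y" using minimizer_exists p by blast
  obtain w where w: "minimizer p2 q2 w" using minimizer_exists p by blast
  have yp: "y \<in> periodic_seqs p1 q1" and wp: "w \<in> periodic_seqs p2 q2"
    using y w by (auto simp: minimizer_def)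
  obtain D1 where D1: "D1 \<ge> 0" "\<And>i. \<bar>y (i + 1) - y i\<bar> \<le> D1"
    using periodic_seqs_bounded_steps[OF yp] p by blast
  obtain D2 where D2: "D2 \<ge> 0" "\<And>i. \<bar>w (i + 1) - w i\<bar> \<le> D2"
    using periodic_seqs_bounded_steps[OF wp] p by blast
  define E where "E = (\<Sum>t\<in>{0..<int r}. \<bar>y t - w t\<bar>)"
  have E: "\<bar>y t - w t\<bar> \<le> E" if "0 \<le> t" "t < int r" for t
    unfolding E_def by (rule member_le_sum) (use that in auto)
  have E0: "E \<ge> 0" by (simp add: E_def sum_nonneg)
  define D where "D = D1 + D2 + E"
  have D: "D \<ge> 0" "D1 \<le> D" "D2 \<le> D" "E \<le> D" using D1(1) D2(1) E0 by (auto simp: D_def)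
  obtain K where K: "lip_const D K" using lip_const_exists D by blast
  have bound: "real n * (wmin (p1 + p2) (q1 + q2) - wmin p1 q1 - wmin p2 q2) \<le> 2 * K * E"
    if n: "n \<ge> 1" "n \<ge> r" for n
  proof -
    let ?N1 = "int n * p1" and ?N = "int n * (p1 + p2)"
    let ?M1 = "int n * q1" and ?M = "int n * (q1 + q2)"
    \<comment> \<open>\<open>n\<close> periods of \<open>y\<close>, then \<open>n\<close> periods of
      \<open>w\<close> shifted by \<open>?N1\<close> and raised by \<open>?M1\<close>. As
      \<open>n \<ge> r\<close>, both pieces have length at least \<open>r\<close>, and at each of
      the two joints the mismatch is that of \<open>y\<close> and \<open>w\<close> on
      \<open>{0..<int r}\<close>, with sum \<open>E\<close>.\<close>
    define u where "u = periodic_ext 0 ?N ?M (\<lambda>i. if i < ?N1 then y i else w (i - ?N1) + of_int ?M1)"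
    define w' where "w' = (\<lambda>i. w (i + - ?N1) + of_int ?M1)"
    have rN: "int r \<le> ?N1" "int r \<le> int n * p2" "1 \<le> ?N1" "1 \<le> int n * p2"
      using n p mult_left_mono[of 1 p1 "int n"] mult_left_mono[of 1 p2 "int n"] by linarith+
    then have N1: "?N1 \<le> ?N" "?N \<ge> 1" by (auto simp: algebra_simps)
    have up: "u \<in> periodic_seqs ?N ?M" unfolding u_def by (rule periodic_ext_in[OF N1(2)])
    have u1: "u i = y i" if "0 \<le> i" "i < ?N1" for i
      using that N1 periodic_ext_eq[of 0 i ?N] unfolding u_def by simp
    have u2: "u i = w' i" if "?N1 \<le> i" "i < ?N" for i
      using that rN periodic_ext_eq[of 0 i ?N] unfolding u_def w'_def by simp
    have tail1: "\<bar>y (t + ?N1) - u (t + ?N1)\<bar> = \<bar>y t - w t\<bar>" if "0 \<le> t" "t < int r" for t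
      using u2[of "t + ?N1"] that rN periodic_seqs_add_mult[OF yp, of t "int n"]
      by (simp add: w'_def algebra_simps)
    have tail2: "\<bar>w' (t + ?N) - u (t + ?N)\<bar> = \<bar>y t - w t\<bar>" if "0 \<le> t" "t < int r" for t
    proof -
      have "t + ?N + - ?N1 = t + int n * p2" by (simp add: algebra_simps)
      then have "w' (t + ?N) = w t + of_int ?M"
        using periodic_seqs_add_mult[OF wp, of t "int n"] by (simp add: w'_def algebra_simps)
      moreover have "u (t + ?N) = y t + of_int ?M"
        using periodic_seqs_add[OF up, of t] u1[of t] that rN by simp
      ultimately show ?thesis by simp
    qed
    have "\<bar>act y 0 ?N1 - act u 0 ?N1\<bar> \<le> K * (\<Sum>i\<in>{?N1..<?N1 + int r}. \<bar>y i - u i\<bar>)"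
    proof (rule act_lip_tail[OF K])
      fix i assume "?N1 \<le> i" "i < ?N1 + int r"
      then show "\<bar>y i - u i\<bar> \<le> D" using tail1[of "i - ?N1"] E[of "i - ?N1"] D by simp
    next
      show "\<bar>y (i + 1) - y i\<bar> \<le> D" for i using D1(2)[of i] D by linarith
    qed (use u1 rN in auto)
    also have "(\<Sum>i\<in>{?N1..<?N1 + int r}. \<bar>y i - u i\<bar>) = E"
      using sum_shift_int[of "\<lambda>i. \<bar>y i - u i\<bar>" 0 ?N1 "int r"] tail1
      by (simp add: E_def add.commute)
    finally have 1: "act u 0 ?N1 \<le> act y 0 ?N1 + K * E" by linarith
    have "\<bar>act w' ?N1 ?N - act u ?N1 ?N\<bar> \<le> K * (\<Sum>i\<in>{?N..<?N + int r}. \<bar>w' i - u i\<bar>)"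
    proof (rule act_lip_tail[OF K])
      fix i assume "?N \<le> i" "i < ?N + int r"
      then show "\<bar>w' i - u i\<bar> \<le> D" using tail2[of "i - ?N"] E[of "i - ?N"] D by simp
    next
      fix i
      show "\<bar>w' (i + 1) - w' i\<bar> \<le> D"
        using D2(2)[of "i - ?N1"] D by (simp add: w'_def algebra_simps)
    qed (use u2 N1 in auto)
    also have "(\<Sum>i\<in>{?N..<?N + int r}. \<bar>w' i - u i\<bar>) = E"
      using sum_shift_int[of "\<lambda>i. \<bar>w' i - u i\<bar>" 0 ?N "int r"] tail2
      by (simp add: E_def add.commute)
    also have "act w' ?N1 ?N = act w 0 (int n * p2)"
      unfolding w'_def act_shift by (simp add: algebra_simps)
    finally have 2: "act u ?N1 ?N \<le> act w 0 (int n * p2) + K * E" by linarith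
    have e: "act y 0 ?N1 = real n * wmin p1 q1" "act w 0 (int n * p2) = real n * wmin p2 q2"
      using act_mult[OF yp, of n] act_mult[OF wp, of n] wmin_eq[OF y] wmin_eq[OF w] p by simp_all
    have "real n * wmin (p1 + p2) (q1 + q2) \<le> act u 0 ?N"
      using wmin_le[OF up N1(2)] wmin_mult[of "p1 + p2" n "q1 + q2"] p n by simp
    also have "\<dots> = act u 0 ?N1 + act u ?N1 ?N"
      by (rule act_split) (use rN N1 in auto)
    also have "\<dots> \<le> real n * wmin p1 q1 + K * E + (real n * wmin p2 q2 + K * E)"
      using 1 2 e by linarith
    finally show ?thesis by (simp add: algebra_simps)
  qed
  show ?thesis
  proof (rule ccontr)
    assume "\<not> ?thesis"
    then have "0 < wmin (p1 + p2) (q1 + q2) - wmin p1 q1 - wmin p2 q2" by simp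
    then obtain m :: nat where m: "2 * K * E < real m * (wmin (p1 + p2) (q1 + q2) - wmin p1 q1 - wmin p2 q2)"
      using reals_Archimedean3 by blast
    let ?n = "max m (Suc r)"
    have "real m * (wmin (p1 + p2) (q1 + q2) - wmin p1 q1 - wmin p2 q2)
        \<le> real ?n * (wmin (p1 + p2) (q1 + q2) - wmin p1 q1 - wmin p2 q2)"
      by (rule mult_right_mono) (use \<open>0 < wmin (p1 + p2) (q1 + q2) - wmin p1 q1 - wmin p2 q2\<close> in auto)
    then show False using m bound[of ?n] by linarith
  qed
qed

end

section \<open>Comparison of two Peierls barriers\<close>

context monotone_potential
begin

section \<open>Constrained minimizers\<close>

definition cmin :: "int \<Rightarrow> int \<Rightarrow> real \<Rightarrow> real" where
  "cmin p q \<xi> = (LEAST w. w \<in> periodic_action r S p ` {x \<in> periodic_seqs p q. x 0 = \<xi>})"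

lemma peierls_pq_eq: "peierls_pq r S p q \<xi> = cmin p q \<xi> - wmin p q"
  by (simp add: peierls_pq_def cmin_def wmin_def)

text \<open>Truncating a competitor from below at \<open>l\<close> and from above at
  \<open>u\<close> does not raise its action, by submodularity and minimality of \<open>l\<close>
  and \<open>u\<close>, and it keeps the value \<xi> at 0. So the minimum may be sought in the order
  interval between \<open>l\<close> and \<open>u\<close>, which is compact.\<close>

lemma constrained_minimizer:
  assumes p: "p \<ge> 1" and l: "minimizer p q l" and u: "minimizer p q u"
    and lu: "\<And>i. l i \<le> u i" and \<xi>: "l 0 \<le> \<xi>" "\<xi> \<le> u 0"
  shows "\<exists>x\<in>periodic_seqs p q. x 0 = \<xi> \<and> (\<forall>i. l i \<le> x i \<and> x i \<le> u i) \<and> act x 0 p = cmin p q \<xi> \<and>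
    (\<forall>z\<in>periodic_seqs p q. z 0 = \<xi> \<longrightarrow> act x 0 p \<le> act z 0 p)"
proof -
  have lp: "l \<in> periodic_seqs p q" and up: "u \<in> periodic_seqs p q"
    using l u by (auto simp: minimizer_def)
  define K where "K = {x \<in> periodic_seqs p q. x 0 = \<xi>} \<inter> PiE UNIV (\<lambda>i. {l i..u i})"
  have "closed (periodic_seqs p q \<inter> {x. x 0 = \<xi>})"
    by (intro closed_Int closed_periodic_seqs closed_Collect_eq continuous_intros
        continuous_on_product_coordinates)
  moreover have "{x \<in> periodic_seqs p q. x 0 = \<xi>} = periodic_seqs p q \<inter> {x. x 0 = \<xi>}" by auto
  ultimately have cK: "compact K"
    unfolding K_def by (metis closed_Int_compact compact_PiE_real compact_Icc)
  have clip: "\<exists>z'\<in>K. act z' 0 p \<le> act z 0 p" if z: "z \<in> periodic_seqs p q" "z 0 = \<xi>" for z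
  proof -
    define v where "v = (\<lambda>i. max (z i) (l i))"
    define w where "w = (\<lambda>i. min (v i) (u i))"
    have vp: "v \<in> periodic_seqs p q" unfolding v_def by (rule periodic_seqs_max[OF z(1) lp])
    have wp: "w \<in> periodic_seqs p q" unfolding w_def by (rule periodic_seqs_min[OF vp up])
    have "act l 0 p \<le> act (\<lambda>i. min (z i) (l i)) 0 p"
      using l periodic_seqs_min[OF z(1) lp] by (simp add: minimizer_def)
    then have 1: "act v 0 p \<le> act z 0 p" using act_submod[of z l 0 p] by (simp add: v_def)
    have "act u 0 p \<le> act (\<lambda>i. max (v i) (u i)) 0 p"
      using u periodic_seqs_max[OF vp up] by (simp add: minimizer_def)
    then have "act w 0 p \<le> act v 0 p" using act_submod[of v u 0 p] by (simp add: w_def)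
    moreover have "w \<in> K" using wp \<xi> z(2) lu by (auto simp: K_def w_def v_def PiE_iff)
    ultimately show ?thesis using 1 by (intro bexI[of _ w]) linarith
  qed
  have "K \<noteq> {}"
    using clip[OF periodic_seqs_linear[OF p, of \<xi> q]] by auto
  then obtain x where x: "x \<in> K" "\<And>z. z \<in> K \<Longrightarrow> act x 0 p \<le> act z 0 p"
    using continuous_attains_inf[OF cK _ continuous_act] by metis
  have min: "act x 0 p \<le> act z 0 p" if "z \<in> periodic_seqs p q" "z 0 = \<xi>" for z
    using clip[OF that] x(2) order_trans by blast
  have "act x 0 p = cmin p q \<xi>"
    unfolding cmin_def periodic_action_eq
    by (rule Least_equality[symmetric]) (use x(1) min in \<open>auto simp: K_def\<close>)
  then show ?thesis using x(1) min by (auto simp: K_def PiE_iff)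
qed

text \<open>Every \<xi> lies between two integer translates of a single minimizer. Since the minimum
  is attained, the \<open>LEAST\<close> in \<open>cmin\<close> has its intended meaning.\<close>

lemma cmin_attained:
  assumes p: "p \<ge> 1"
  shows "\<exists>x\<in>periodic_seqs p q. x 0 = \<xi> \<and> act x 0 p = cmin p q \<xi> \<and>
    (\<forall>z\<in>periodic_seqs p q. z 0 = \<xi> \<longrightarrow> act x 0 p \<le> act z 0 p)"
proof -
  obtain y where y: "minimizer p q y" using minimizer_exists[OF p] by blast
  define m where "m = \<lfloor>\<xi> - y 0\<rfloor>"
  have "\<exists>x\<in>periodic_seqs p q. x 0 = \<xi> \<and> (\<forall>i. y (i + 0) + of_int m \<le> x i \<and> x i \<le> y (i + 0) + of_int (m + 1))
    \<and> act x 0 p = cmin p q \<xi> \<and> (\<forall>z\<in>periodic_seqs p q. z 0 = \<xi> \<longrightarrow> act x 0 p \<le> act z 0 p)"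
    by (rule constrained_minimizer[OF p minimizer_translate[OF y] minimizer_translate[OF y]])
       (use p in \<open>auto simp: m_def, linarith+\<close>)
  then show ?thesis by blast
qed

lemma cmin_le:
  assumes p: "p \<ge> 1" and z: "z \<in> periodic_seqs p q" "z 0 = \<xi>"
  shows "cmin p q \<xi> \<le> act z 0 p"
  using cmin_attained[OF p, of q \<xi>] z by metis

lemma wmin_le_cmin: "p \<ge> 1 \<Longrightarrow> wmin p q \<le> cmin p q \<xi>"
  using cmin_attained[of p q \<xi>] wmin_le[of _ p q] by metis

lemma steps_between:
  fixes l u x :: "int \<Rightarrow> real"
  assumes "\<And>i. \<bar>l (i + 1) - l i\<bar> \<le> c" "\<And>i. l i \<le> x i \<and> x i \<le> u i" "\<And>i. u i \<le> l i + 1"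
  shows "\<bar>x (i + 1) - x i\<bar> \<le> c + 1"
  using assms(1)[of i] assms(2)[of i] assms(2)[of "i + 1"] assms(3)[of i] assms(3)[of "i + 1"]
  by linarith

text \<open>In the following, \<open>{a..<a + p}\<close> is the window and \<open>H\<close> adds up, over its first \<open>r\<close> indices, the
  gaps and drifts of \<open>l\<close> and \<open>u\<close>; every cut costs at most \<open>K H\<close>.\<close>

context
  fixes D K :: real and N M p q a :: int and l u :: "int \<Rightarrow> real" and H :: real
  assumes lipK: "lip_const D K"
    and p: "1 \<le> p" "int r \<le> p" and Np: "1 \<le> N - p" "int r \<le> N - p" and a: "- p < a" "a \<le> 0"
    and l: "minimizer N M l" and u: "minimizer N M u"
    and lu: "\<And>i. l i \<le> u i" and gap1: "\<And>i. u i \<le> l i + 1"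
    and stl: "\<And>i. \<bar>l (i + 1) - l i\<bar> \<le> D - 8" and stu: "\<And>i. \<bar>u (i + 1) - u i\<bar> \<le> D - 8"
    and dl: "\<And>i. \<bar>l i + of_int q - l (i + p)\<bar> \<le> 2" and du: "\<And>i. \<bar>u i + of_int q - u (i + p)\<bar> \<le> 2"
    and H: "H = (\<Sum>i\<in>{a..<a + int r}. (u i - l i) + (u (i + p) - l (i + p))
        + \<bar>l i + of_int q - l (i + p)\<bar> + \<bar>u i + of_int q - u (i + p)\<bar>)"
begin

lemma D_ge: "D \<ge> 8" using stl[of 0] by linarith

lemma lp: "l \<in> periodic_seqs N M" and up: "u \<in> periodic_seqs N M"
  using l u by (auto simp: minimizer_def)

lemma N_ge: "N \<ge> 1" using p Np by linarith

lemma K_sum_le_H: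
  assumes "\<And>i. f i \<le> (u i - l i) + (u (i + p) - l (i + p))
        + \<bar>l i + of_int q - l (i + p)\<bar> + \<bar>u i + of_int q - u (i + p)\<bar>"
  shows "K * (\<Sum>i\<in>{a..<a + int r}. f i) \<le> K * H"
  unfolding H using assms lip_const_nonneg[OF lipK] by (intro mult_left_mono sum_mono) auto

lemma closing:
  assumes st: "\<And>i. \<bar>v (i + 1) - v i\<bar> \<le> D"
    and cl: "\<And>i. \<bar>v i + of_int q - v (i + p)\<bar> \<le> (u i - l i) + (u (i + p) - l (i + p))
        + \<bar>l i + of_int q - l (i + p)\<bar> + \<bar>u i + of_int q - u (i + p)\<bar>"
  shows "act (periodic_ext a p q v) 0 p \<le> act v a (a + p) + K * H"
proof -
  \<comment> \<open>The two gaps are at most 1 and the two drifts at most 2, together at most 6,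
    while \<open>D \<ge> 8\<close>.\<close>
  have vD: "\<bar>v i + of_int q - v (i + p)\<bar> \<le> D" for i
    using cl[of i] gap1[of i] gap1[of "i + p"] dl[of i] du[of i] D_ge by linarith
  show ?thesis
    using periodic_closing[where u=v and a=a and q=q, OF lipK p st vD] K_sum_le_H[OF cl] by linarith
qed

lemma wmin_closing:
  assumes st: "\<And>i. \<bar>v (i + 1) - v i\<bar> \<le> D"
    and cl: "\<And>i. \<bar>v i + of_int q - v (i + p)\<bar> \<le> (u i - l i) + (u (i + p) - l (i + p))
        + \<bar>l i + of_int q - l (i + p)\<bar> + \<bar>u i + of_int q - u (i + p)\<bar>"
  shows "wmin p q \<le> act v a (a + p) + K * H"
  using closing[where v=v, OF st cl] wmin_le[OF periodic_ext_in[OF p(1), of a q v] p(1)] by linarith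

text \<open>The complement of the window closes up to a sequence of type \<open>(N - p, M - q)\<close>.\<close>

lemma window_le:
  assumes y: "minimizer N M y" and st: "\<And>i. \<bar>y (i + 1) - y i\<bar> \<le> D"
    and cl: "\<And>i. \<bar>y i + of_int q - y (i + p)\<bar> \<le> 2"
      "\<And>i. \<bar>y i + of_int q - y (i + p)\<bar> \<le> (u i - l i) + (u (i + p) - l (i + p))
        + \<bar>l i + of_int q - l (i + p)\<bar> + \<bar>u i + of_int q - u (i + p)\<bar>"
  shows "act y a (a + p) \<le> wmin p q + K * H"
proof -
  have yp: "y \<in> periodic_seqs N M" using y by (simp add: minimizer_def)
  let ?z = "periodic_ext (a + p) (N - p) (M - q) y"
  \<comment> \<open>By periodicity of \<open>y\<close>, closing the complement meets the same drift
    as closing the window.\<close>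
  have eq: "\<bar>y (i + p) + of_int (M - q) - y (i + p + (N - p))\<bar> = \<bar>y i + of_int q - y (i + p)\<bar>" for i
    using periodic_seqs_add[OF yp, of i] by simp
  have "act ?z 0 (N - p) \<le> act y (a + p) (a + p + (N - p))
      + K * (\<Sum>i\<in>{a + p..<a + p + int r}. \<bar>y i + of_int (M - q) - y (i + (N - p))\<bar>)"
  proof (rule periodic_closing[where u=y, OF lipK Np st])
    fix i
    show "\<bar>y i + of_int (M - q) - y (i + (N - p))\<bar> \<le> D"
      using eq[of "i - p"] cl(1)[of "i - p"] D_ge by simp
  qed
  also have "(\<Sum>i\<in>{a + p..<a + p + int r}. \<bar>y i + of_int (M - q) - y (i + (N - p))\<bar>)
      = (\<Sum>i\<in>{a..<a + int r}. \<bar>y i + of_int q - y (i + p)\<bar>)"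
    using sum_shift_int[of "\<lambda>i. \<bar>y i + of_int (M - q) - y (i + (N - p))\<bar>" a p "a + int r"]
    unfolding eq by (simp only: ac_simps)
  finally have "act ?z 0 (N - p) \<le> act y (a + p) (a + N) + K * H"
    using K_sum_le_H[OF cl(2)] by simp
  then have "wmin (N - p) (M - q) \<le> act y (a + p) (a + N) + K * H"
    using wmin_le[OF periodic_ext_in[OF Np(1), of "a + p" "M - q" y] Np(1)] by linarith
  moreover have "wmin N M \<le> wmin p q + wmin (N - p) (M - q)"
    using wmin_subadditive[OF p(1) Np(1), of q "M - q"] by simp
  moreover have "act y a (a + N) = act y a (a + p) + act y (a + p) (a + N)"
    by (rule act_split) (use p Np in auto)
  moreover have "act y a (a + N) = wmin N M"
    using act_window[OF yp, of a] N_ge wmin_eq[OF y] by simp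
  ultimately show ?thesis by linarith
qed

lemma window_l: "act l a (a + p) \<le> wmin p q + K * H"
proof (rule window_le[OF l])
  fix i
  show "\<bar>l (i + 1) - l i\<bar> \<le> D" using stl[of i] by simp
  show "\<bar>l i + of_int q - l (i + p)\<bar> \<le> (u i - l i) + (u (i + p) - l (i + p))
        + \<bar>l i + of_int q - l (i + p)\<bar> + \<bar>u i + of_int q - u (i + p)\<bar>"
    using lu[of i] lu[of "i + p"] by simp
qed (rule dl)

lemma window_u: "act u a (a + p) \<le> wmin p q + K * H"
proof (rule window_le[OF u])
  fix i
  show "\<bar>u (i + 1) - u i\<bar> \<le> D" using stu[of i] by simp
  show "\<bar>u i + of_int q - u (i + p)\<bar> \<le> (u i - l i) + (u (i + p) - l (i + p))
        + \<bar>l i + of_int q - l (i + p)\<bar> + \<bar>u i + of_int q - u (i + p)\<bar>"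
    using lu[of i] lu[of "i + p"] by simp
qed (rule du)

text \<open>All sequences stay between \<open>l\<close> and \<open>u\<close>, so the mismatch at a
  joint is at most the gap there. The joint at \<open>a + p\<close> contributes the gaps at
  \<open>i + p\<close>, the one at \<open>a + N\<close> those at \<open>i\<close> by periodicity;
  both kinds are contained in \<open>H\<close>.\<close>

lemma splice:
  assumes v: "\<And>i. l i \<le> v i \<and> v i \<le> u i" and w: "\<And>i. l i \<le> w i \<and> w i \<le> u i"
  shows "\<exists>z\<in>periodic_seqs N M. (\<forall>i. a \<le> i \<longrightarrow> i < a + p \<longrightarrow> z i = v i) \<and>
    act z 0 N \<le> act v a (a + p) + act w (a + p) (a + N) + K * H"
proof -
  define z where "z = periodic_ext a N M (\<lambda>i. if i < a + p then v i else w i)"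
  have z: "z \<in> periodic_seqs N M" unfolding z_def by (rule periodic_ext_in[OF N_ge])
  have zb: "l i \<le> z i \<and> z i \<le> u i" for i
    unfolding z_def by (rule periodic_ext_between[OF N_ge lp up]) (use v w in auto)
  have zv: "z i = v i" if "a \<le> i" "i < a + p" for i
    using that Np unfolding z_def by (subst periodic_ext_eq) auto
  have zw: "z i = w i" if "a + p \<le> i" "i < a + N" for i
    using that p unfolding z_def by (subst periodic_ext_eq) auto
  have close: "\<bar>x i - z i\<bar> \<le> u i - l i" if "\<And>i. l i \<le> x i \<and> x i \<le> u i" for x i
    using that[of i] zb[of i] by linarith
  have st: "\<bar>x (i + 1) - x i\<bar> \<le> D" if "\<And>i. l i \<le> x i \<and> x i \<le> u i" for x i
    using steps_between[where l=l and u=u and x=x and c="D - 8" and i=i, OF stl that gap1] by linarith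
  have tail: "\<bar>act x b c - act z b c\<bar> \<le> K * (\<Sum>i\<in>{c..<c + int r}. u i - l i)"
    if "b \<le> c" and xb: "\<And>i. l i \<le> x i \<and> x i \<le> u i" and "\<And>i. b \<le> i \<Longrightarrow> i < c \<Longrightarrow> x i = z i" for x b c
  proof -
    have "\<bar>x i - z i\<bar> \<le> D" for i using close[OF xb, of i] gap1[of i] D_ge by linarith
    then have "\<bar>act x b c - act z b c\<bar> \<le> K * (\<Sum>i\<in>{c..<c + int r}. \<bar>x i - z i\<bar>)"
      by (intro act_lip_tail[where D=D] lipK that st[OF xb]) auto
    also have "\<dots> \<le> K * (\<Sum>i\<in>{c..<c + int r}. u i - l i)"
      by (intro mult_left_mono sum_mono close[OF xb] lip_const_nonneg[OF lipK])
    finally show ?thesis .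
  qed
  have "\<bar>act v a (a + p) - act z a (a + p)\<bar> \<le> K * (\<Sum>i\<in>{a + p..<a + p + int r}. u i - l i)"
    by (rule tail) (use v zv p in auto)
  also have "(\<Sum>i\<in>{a + p..<a + p + int r}. u i - l i) = (\<Sum>i\<in>{a..<a + int r}. u (i + p) - l (i + p))"
    using sum_shift_int[of "\<lambda>i. u i - l i" a p "a + int r"] by (simp only: ac_simps)
  finally have 1: "act z a (a + p) \<le> act v a (a + p) + K * (\<Sum>i\<in>{a..<a + int r}. u (i + p) - l (i + p))"
    by linarith
  have "\<bar>act w (a + p) (a + N) - act z (a + p) (a + N)\<bar> \<le> K * (\<Sum>i\<in>{a + N..<a + N + int r}. u i - l i)"
    by (rule tail) (use w zw Np in auto)
  also have "(\<Sum>i\<in>{a + N..<a + N + int r}. u i - l i) = (\<Sum>i\<in>{a..<a + int r}. u (i + N) - l (i + N))"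
    using sum_shift_int[of "\<lambda>i. u i - l i" a N "a + int r"] by (simp only: ac_simps)
  also have "\<dots> = (\<Sum>i\<in>{a..<a + int r}. u i - l i)"
    by (simp add: periodic_seqs_add[OF lp] periodic_seqs_add[OF up])
  finally have 2: "act z (a + p) (a + N) \<le> act w (a + p) (a + N) + K * (\<Sum>i\<in>{a..<a + int r}. u i - l i)"
    by linarith
  have "K * (\<Sum>i\<in>{a..<a + int r}. (u i - l i) + (u (i + p) - l (i + p))) \<le> K * H"
    by (rule K_sum_le_H) simp
  then have 3: "K * (\<Sum>i\<in>{a..<a + int r}. u i - l i) + K * (\<Sum>i\<in>{a..<a + int r}. u (i + p) - l (i + p)) \<le> K * H"
    by (simp only: sum.distrib distrib_left)
  have "act z a (a + N) = act z a (a + p) + act z (a + p) (a + N)"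
    by (rule act_split) (use p Np in auto)
  moreover have "act z a (a + N) = act z 0 N" using act_window[OF z, of a] N_ge by simp
  ultimately have "act z 0 N \<le> act v a (a + p) + act w (a + p) (a + N) + K * H"
    using 1 2 3 by linarith
  then show ?thesis using z zv by blast
qed

text \<open>The window of the constrained minimizer \<open>x\<close> closes up to a competitor for
  \<open>cmin p q \<xi>\<close>. Putting \<open>l\<close> in place of \<open>x\<close> on the window
  gives a competitor for \<open>wmin N M\<close>, which bounds the window action of \<open>x\<close>
  by the barrier of \<open>(N, M)\<close> plus the window action of \<open>l\<close>. The three
  errors come from \<open>closing\<close>, \<open>splice\<close> and
  \<open>window_l\<close>.\<close>

lemma barrier_window_le:
  assumes \<xi>: "l 0 \<le> \<xi>" "\<xi> \<le> u 0"
  shows "peierls_pq r S p q \<xi> \<le> peierls_pq r S N M \<xi> + 3 * (K * H)"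
proof -
  obtain x where x: "x \<in> periodic_seqs N M" "x 0 = \<xi>" "\<And>i. l i \<le> x i \<and> x i \<le> u i" "act x 0 N = cmin N M \<xi>"
    using constrained_minimizer[OF N_ge l u lu \<xi>] by blast
  let ?z = "periodic_ext a p q x"
  \<comment> \<open>By \<open>- p < a \<le> 0\<close> the index 0 lies in the window, so the
    constraint survives.\<close>
  have "?z 0 = \<xi>" using periodic_ext_eq[of a 0 p q x] a x(2) by simp
  then have "cmin p q \<xi> \<le> act ?z 0 p" by (intro cmin_le periodic_ext_in p)
  also have "\<dots> \<le> act x a (a + p) + K * H"
  proof (rule closing)
    fix i
    show "\<bar>x (i + 1) - x i\<bar> \<le> D" using steps_between[where l=l and u=u and x=x and c="D - 8" and i=i, OF stl x(3) gap1] by linarith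
    show "\<bar>x i + of_int q - x (i + p)\<bar> \<le> (u i - l i) + (u (i + p) - l (i + p))
        + \<bar>l i + of_int q - l (i + p)\<bar> + \<bar>u i + of_int q - u (i + p)\<bar>"
      using x(3)[of i] x(3)[of "i + p"] by linarith
  qed
  finally have 1: "cmin p q \<xi> \<le> act x a (a + p) + K * H" .
  obtain z where "z \<in> periodic_seqs N M" "act z 0 N \<le> act l a (a + p) + act x (a + p) (a + N) + K * H"
    using splice[of l x] lu x(3) by blast
  then have "wmin N M \<le> act l a (a + p) + act x (a + p) (a + N) + K * H"
    using wmin_le[OF _ N_ge] by fastforce
  moreover have "act x a (a + N) = act x a (a + p) + act x (a + p) (a + N)"
    by (rule act_split) (use p Np in auto)
  moreover have "act x a (a + N) = cmin N M \<xi>"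
    using act_window[OF x(1), of a] N_ge x(4) by simp
  ultimately show ?thesis
    using 1 window_l unfolding peierls_pq_eq by linarith
qed

text \<open>Here \<open>x\<close> is of type \<open>(p, q)\<close> and \<open>l\<close>,
  \<open>u\<close> are of type \<open>(N, M)\<close>, so the truncation takes place on the window
  only: the discarded parts, a minimum and a maximum, are closed up and compared with
  \<open>wmin p q\<close>. When the result is inserted into \<open>l\<close>, the window action of
  \<open>l\<close> cancels and that of \<open>u\<close> is bounded by \<open>window_u\<close>. Two
  closings, one splice and \<open>window_u\<close> make up the factor 4.\<close>

lemma barrier_le_window:
  assumes \<xi>: "l 0 \<le> \<xi>" "\<xi> \<le> u 0"
    and x: "x \<in> periodic_seqs p q" "x 0 = \<xi>" "act x 0 p = cmin p q \<xi>" "\<And>i. \<bar>x (i + 1) - x i\<bar> \<le> D"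
  shows "peierls_pq r S N M \<xi> \<le> peierls_pq r S p q \<xi> + 4 * (K * H)"
proof -
  define v where "v = (\<lambda>i. max (x i) (l i))"
  define w where "w = (\<lambda>i. min (v i) (u i))"
  have wb: "l i \<le> w i \<and> w i \<le> u i" for i using lu[of i] by (auto simp: w_def v_def)
  \<comment> \<open>As \<open>l \<le> u\<close>, the lower truncation disappears from the discarded
    maximum. What is closed up then involves only \<open>x\<close>, which has no drift, and
    \<open>u\<close>.\<close>
  have max_eq: "(\<lambda>i. max (v i) (u i)) = (\<lambda>i. max (x i) (u i))"
    using lu by (auto simp: v_def fun_eq_iff max_def intro: antisym order_trans)
  have xq: "x (i + p) = x i + of_int q" for i by (rule periodic_seqs_add[OF x(1)])
  have "wmin p q \<le> act (\<lambda>i. min (x i) (l i)) a (a + p) + K * H"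
  proof (rule wmin_closing)
    fix i
    show "\<bar>min (x (i + 1)) (l (i + 1)) - min (x i) (l i)\<bar> \<le> D"
      using x(4)[of i] stl[of i] by (simp add: min_def) linarith
    show "\<bar>min (x i) (l i) + of_int q - min (x (i + p)) (l (i + p))\<bar> \<le> (u i - l i) + (u (i + p) - l (i + p))
        + \<bar>l i + of_int q - l (i + p)\<bar> + \<bar>u i + of_int q - u (i + p)\<bar>"
      using lu[of i] lu[of "i + p"] unfolding xq min_def by (simp split: if_split) linarith
  qed
  then have 1: "act v a (a + p) \<le> act x a (a + p) + act l a (a + p) - wmin p q + K * H"
    using act_submod[of x l a "a + p"] by (simp add: v_def)
  have "wmin p q \<le> act (\<lambda>i. max (x i) (u i)) a (a + p) + K * H"
  proof (rule wmin_closing)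
    fix i
    show "\<bar>max (x (i + 1)) (u (i + 1)) - max (x i) (u i)\<bar> \<le> D"
      using x(4)[of i] stu[of i] by (simp add: max_def) linarith
    show "\<bar>max (x i) (u i) + of_int q - max (x (i + p)) (u (i + p))\<bar> \<le> (u i - l i) + (u (i + p) - l (i + p))
        + \<bar>l i + of_int q - l (i + p)\<bar> + \<bar>u i + of_int q - u (i + p)\<bar>"
      using lu[of i] lu[of "i + p"] unfolding xq max_def by (simp split: if_split) linarith
  qed
  then have 2: "act w a (a + p) \<le> act v a (a + p) + act u a (a + p) - wmin p q + K * H"
    using act_submod[of v u a "a + p"] by (simp add: w_def max_eq)
  obtain z where z: "z \<in> periodic_seqs N M" "\<And>i. a \<le> i \<Longrightarrow> i < a + p \<Longrightarrow> z i = w i"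
      "act z 0 N \<le> act w a (a + p) + act l (a + p) (a + N) + K * H"
    using splice[of w l] wb lu by blast
  have "z 0 = \<xi>" using z(2)[of 0] a x(2) \<xi> by (simp add: w_def v_def)
  then have "cmin N M \<xi> \<le> act z 0 N" by (intro cmin_le N_ge z)
  moreover have "act l a (a + N) = act l a (a + p) + act l (a + p) (a + N)"
    by (rule act_split) (use p Np in auto)
  moreover have "act l a (a + N) = wmin N M"
    using act_window[OF lp, of a] N_ge wmin_eq[OF l] by simp
  moreover have "act x a (a + p) = cmin p q \<xi>"
    using act_window[OF x(1), of a] p x(3) by simp
  ultimately show ?thesis
    using 1 2 z(3) window_u unfolding peierls_pq_eq by linarith
qed

end

end

section \<open>The estimate for rational frequencies\<close>

lemma sum_telescope_int:
  fixes h :: "int \<Rightarrow> real"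
  assumes "a \<le> b"
  shows "(\<Sum>i\<in>{a..<b}. h (i + 1) - h i) = h b - h a"
  using assms
proof (induction b rule: int_ge_induct)
  case base
  then show ?case by simp
next
  case (step b)
  then have "{a..<b + 1} = insert b {a..<b}" by auto
  then show ?case using step by simp
qed

text \<open>Group the sum by residues mod \<open>P\<close>: together they carry mass 1, and each is
  hit at most \<open>B\<close> times.\<close>

lemma sum_residues_le:
  fixes d :: "int \<Rightarrow> real" and \<phi> :: "'a \<Rightarrow> int"
  assumes P: "P \<ge> 1" and d0: "\<And>c. d c \<ge> 0" and dP: "\<And>c. d (c + P) = d c"
    and d1: "(\<Sum>c\<in>{0..<P}. d c) = 1" and Z: "finite Z"
    and card: "\<And>c. real (card {z \<in> Z. \<phi> z mod P = c}) \<le> B"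
  shows "(\<Sum>z\<in>Z. d (\<phi> z)) \<le> B"
proof -
  have dm: "d c = d (c mod P)" for c
    using quasiperiodic_add_mult[of d P 0 "c mod P" "c div P"] dP by simp
  have "(\<Sum>z\<in>Z. d (\<phi> z)) = (\<Sum>z\<in>Z. d (\<phi> z mod P))"
    by (rule sum.cong[OF refl]) (rule dm)
  also have "\<dots> = (\<Sum>c\<in>{0..<P}. \<Sum>z\<in>{z \<in> Z. \<phi> z mod P = c}. d (\<phi> z mod P))"
    by (rule sum.group[symmetric]) (use P Z in auto)
  also have "\<dots> = (\<Sum>c\<in>{0..<P}. real (card {z \<in> Z. \<phi> z mod P = c}) * d c)"
    by (rule sum.cong) auto
  also have "\<dots> \<le> (\<Sum>c\<in>{0..<P}. B * d c)"
    by (intro sum_mono mult_right_mono card d0)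
  also have "\<dots> = B" using d1 by (simp add: sum_distrib_left[symmetric])
  finally show ?thesis .
qed

lemma card_multiples_le:
  fixes lo W :: real and P :: int
  assumes P: "P \<ge> 1" and W: "W \<ge> 0" and M: "\<And>m. m \<in> M \<Longrightarrow> lo \<le> of_int P * of_int m \<and> of_int P * of_int m \<le> lo + W"
  shows "real (card M) \<le> W / of_int P + 1"
proof -
  let ?a = "\<lceil>lo / of_int P\<rceil>" and ?b = "\<lfloor>(lo + W) / of_int P\<rfloor>"
  have "M \<subseteq> {?a..?b}"
    using M P by (fastforce simp: ceiling_le_iff le_floor_iff field_simps)
  then have "card M \<le> card {?a..?b}" by (intro card_mono) auto
  then have "real (card M) \<le> real (nat (?b - ?a + 1))" by simp
  also have "\<dots> \<le> W / of_int P + 1"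
  proof (cases "?b - ?a + 1 \<ge> 0")
    case True
    have "of_int ?b - of_int ?a \<le> (lo + W) / of_int P - lo / of_int P" by linarith
    also have "\<dots> = W / of_int P" by (simp add: add_divide_distrib)
    finally show ?thesis using True by simp
  next
    case False
    then show ?thesis using W P by simp
  qed
  finally show ?thesis .
qed

lemma dvd_diff_imp_eq:
  fixes i j p :: int
  assumes "p dvd i - j" "\<bar>i - j\<bar> < p"
  shows "i = j"
proof (rule ccontr)
  assume "i \<noteq> j"
  then have "\<bar>p\<bar> \<le> \<bar>i - j\<bar>" using assms(1) by (intro dvd_imp_le_int) auto
  then show False using assms(2) by linarith
qed

text \<open>The increments \<open>h (c + 1) - h c\<close> are nonnegative and
  \<open>P\<close>-periodic and sum up to 1 over a period, so they form a probability distribution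
  on the residues mod \<open>P\<close>. Gaps and drifts are sums of such increments and are
  estimated by counting.\<close>

definition birkhoff_fun :: "int \<Rightarrow> (int \<Rightarrow> real) \<Rightarrow> bool" where
  "birkhoff_fun P h \<longleftrightarrow> P \<ge> 1 \<and> (\<forall>i. h i \<le> h (i + 1)) \<and> (\<forall>i. h (i + P) = h i + 1)"

context
  fixes P :: int and h :: "int \<Rightarrow> real"
  assumes h: "birkhoff_fun P h"
begin

lemma birkhoff_P: "P \<ge> 1" using h by (simp add: birkhoff_fun_def)

lemma birkhoff_mono: "i \<le> j \<Longrightarrow> h i \<le> h j"
  by (rule mono_int_stepI) (use h in \<open>auto simp: birkhoff_fun_def\<close>)

lemma birkhoff_add_mult: "h (i + n * P) = h i + of_int n"
  using quasiperiodic_add_mult[of h P 1 i n] h by (simp add: birkhoff_fun_def)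

lemma birkhoff_gap_le_1: "h (i + 1) \<le> h i + 1"
  using birkhoff_mono[of "i + 1" "i + P"] birkhoff_add_mult[of i 1] birkhoff_P by simp

lemma birkhoff_dist: "\<bar>h (i + s) - h i\<bar> \<le> \<bar>of_int s\<bar> / of_int P + 1"
proof -
  have pos: "0 \<le> h (c + t) - h c \<and> h (c + t) - h c \<le> of_int t / of_int P + 1" if t: "t \<ge> 0" for c t
  proof -
    have "t div P * P + t mod P = t" "t mod P < P" using birkhoff_P by simp_all
    then have "t \<le> (t div P + 1) * P" by (simp only: distrib_right)
    then have "h (c + t) \<le> h c + of_int (t div P + 1)"
      using birkhoff_mono[of "c + t" "c + (t div P + 1) * P"] birkhoff_add_mult[of c "t div P + 1"] by simp
    moreover have "real_of_int (t div P) \<le> of_int t / of_int P"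
      using floor_divide_of_int_eq[of t P, where ?'a=real] by (metis of_int_floor_le)
    ultimately show ?thesis using birkhoff_mono[of c "c + t"] t by simp
  qed
  show ?thesis
  proof (cases "s \<ge> 0")
    case True
    then show ?thesis using pos[of s i] by simp
  next
    case False
    then show ?thesis using pos[of "- s" "i + s"] by simp
  qed
qed

lemma birkhoff_bracket: "\<exists>j. h j \<le> \<xi> \<and> \<xi> \<le> h (j + 1)"
proof -
  define n where "n = \<lfloor>\<xi> - h 0\<rfloor>"
  have lo: "h (n * P) \<le> \<xi>" and hi: "\<xi> < h ((n + 1) * P)"
    using birkhoff_add_mult[of 0 n] birkhoff_add_mult[of 0 "n + 1"] unfolding n_def by (simp, linarith)+
  define A where "A = {j \<in> {n * P..(n + 1) * P}. h j \<le> \<xi>}"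
  have "n * P \<in> A" using lo birkhoff_P by (simp add: A_def distrib_right)
  moreover have "A \<subseteq> {n * P..(n + 1) * P}" by (auto simp: A_def)
  ultimately have A: "finite A" "A \<noteq> {}" by (auto intro: finite_subset)
  define j where "j = Max A"
  have jA: "j \<in> A" using Max_in[OF A] by (simp add: j_def)
  then have j: "h j \<le> \<xi>" "n * P \<le> j" "j \<le> (n + 1) * P" by (auto simp: A_def)
  have "j \<noteq> (n + 1) * P" using j(1) hi by auto
  then have "j + 1 \<in> {n * P..(n + 1) * P}" using j by auto
  moreover have "j + 1 \<notin> A" using Max_ge[OF A(1), of "j + 1"] by (auto simp: j_def)
  ultimately have "\<xi> \<le> h (j + 1)" by (auto simp: A_def)
  then show ?thesis using j(1) by blast
qed

lemma birkhoff_steps_sum: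
  fixes \<phi> :: "'a \<Rightarrow> int"
  assumes "finite Z" "\<And>c. real (card {z \<in> Z. \<phi> z mod P = c}) \<le> B"
  shows "(\<Sum>z\<in>Z. h (\<phi> z + 1) - h (\<phi> z)) \<le> B"
proof (rule sum_residues_le[OF birkhoff_P _ _ _ assms])
  show "0 \<le> h (c + 1) - h c" for c using h by (simp add: birkhoff_fun_def)
  show "h (c + P + 1) - h (c + P) = h (c + 1) - h c" for c
    using birkhoff_add_mult[of c 1] birkhoff_add_mult[of "c + 1" 1] by (simp add: ac_simps)
  show "(\<Sum>c\<in>{0..<P}. h (c + 1) - h c) = 1"
    using birkhoff_P sum_telescope_int[of 0 P h] birkhoff_add_mult[of 0 1] by simp
qed

text \<open>\<open>Q\<close> is a unit mod \<open>P\<close>, so at most \<open>P\<close> consecutive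
  values of \<open>i\<close> give pairwise distinct residues of \<open>i * Q + j\<close>.\<close>

lemma gap_sum_le_1:
  assumes cop: "coprime P Q" and p: "p \<le> P"
  shows "(\<Sum>i\<in>{a..<a + p}. h (i * Q + j + 1) - h (i * Q + j)) \<le> 1"
proof (rule birkhoff_steps_sum)
  fix c
  define Z where "Z = {i \<in> {a..<a + p}. (i * Q + j) mod P = c}"
  have eq: "i = i'" if "i \<in> Z" "i' \<in> Z" for i i'
  proof -
    have "(i * Q + j) mod P = (i' * Q + j) mod P" using that by (simp add: Z_def)
    then have "P dvd (i * Q + j) - (i' * Q + j)" by (simp add: mod_eq_dvd_iff)
    then have "P dvd (i - i') * Q" by (simp add: algebra_simps)
    then have "P dvd i - i'" using cop by (simp add: coprime_dvd_mult_left_iff)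
    moreover have "\<bar>i - i'\<bar> < P" using that p by (auto simp: Z_def)
    ultimately show ?thesis by (rule dvd_diff_imp_eq)
  qed
  have "finite Z" by (rule finite_subset[of _ "{a..<a + p}"]) (auto simp: Z_def)
  then have "card Z \<le> Suc 0" by (intro iffD2[OF card_le_Suc0_iff_eq] ballI eq)
  then show "real (card {i \<in> {a..<a + p}. (i * Q + j) mod P = c}) \<le> 1" by (simp add: Z_def)
qed simp

text \<open>With \<open>\<kappa> = p Q - q P\<close>, a step \<open>(i, s)\<close> contributing to residue \<open>c\<close> determines the integer
  \<open>m = i q - l p\<close>, where \<open>i Q + j + s = l P + c\<close>. Since \<open>P m = p (c - j) - (p s + i \<kappa>)\<close>, it ranges
  over an interval of length \<open>2 p \<bar>\<kappa>\<bar> / P\<close>, and it determines \<open>(i, s)\<close> because \<open>p\<close> and \<open>q\<close> are coprime.\<close>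

lemma drift_sum_le:
  assumes cop: "coprime p q" and p: "p \<ge> 1" and \<kappa>: "\<kappa> = p * Q - q * P"
  shows "(\<Sum>i\<in>{a..<a + p}. \<bar>h (i * Q + j) - h (i * Q + j + \<kappa>)\<bar>) \<le> 2 * of_int p * \<bar>of_int \<kappa>\<bar> / of_int P + 1"
proof -
  \<comment> \<open>The offsets of the unit steps between \<open>c\<close> and
    \<open>c + \<kappa>\<close>, for either sign of \<kappa>.\<close>
  define I where "I = {min 0 \<kappa>..<max 0 \<kappa>}"
  have inner: "\<bar>h c - h (c + \<kappa>)\<bar> = (\<Sum>s\<in>I. h (c + s + 1) - h (c + s))" for c
  proof (cases "\<kappa> \<ge> 0")
    case True
    then show ?thesis
      using sum_telescope_int[of 0 \<kappa> "\<lambda>s. h (c + s)"] birkhoff_mono[of c "c + \<kappa>"]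
      by (simp add: I_def add.assoc)
  next
    case False
    then show ?thesis
      using sum_telescope_int[of \<kappa> 0 "\<lambda>s. h (c + s)"] birkhoff_mono[of "c + \<kappa>" c]
      by (simp add: I_def add.assoc)
  qed
  have "(\<Sum>i\<in>{a..<a + p}. \<bar>h (i * Q + j) - h (i * Q + j + \<kappa>)\<bar>)
      = (\<Sum>z\<in>{a..<a + p} \<times> I. h ((\<lambda>(i, s). i * Q + j + s) z + 1) - h ((\<lambda>(i, s). i * Q + j + s) z))"
    unfolding inner sum.cartesian_product by (rule sum.cong) auto
  also have "\<dots> \<le> 2 * of_int p * \<bar>of_int \<kappa>\<bar> / of_int P + 1"
  proof (rule birkhoff_steps_sum)
    show "finite ({a..<a + p} \<times> I)" by (simp add: I_def)
    fix c
    define Z where "Z = {z \<in> {a..<a + p} \<times> I. (\<lambda>(i, s). i * Q + j + s) z mod P = c}"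
    \<comment> \<open>\<open>g\<close> is the integer \<open>m = i q - l p\<close>, with
      \<open>l\<close> the quotient of \<open>i Q + j + s\<close> by \<open>P\<close>.\<close>
    define g where "g = (\<lambda>(i, s). i * q - ((i * Q + j + s) div P) * p)"
    have key: "P * g (i, s) = p * (c - j) - (p * s + i * \<kappa>)" if "(i, s) \<in> Z" for i s
    proof -
      have "i * Q + j + s = ((i * Q + j + s) div P) * P + c"
        using that div_mult_mod_eq[of "i * Q + j + s" P] by (simp add: Z_def)
      then have "p * (((i * Q + j + s) div P) * P) = p * (i * Q + j + s - c)" by simp
      then show ?thesis unfolding g_def \<kappa> by (simp add: algebra_simps)
    qed
    have inj: "inj_on g Z"
    proof (rule inj_onI)
      fix z z' assume z: "z \<in> Z" "z' \<in> Z" and eq: "g z = g z'"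
      obtain i s where zz: "z = (i, s)" by (cases z)
      obtain i' s' where zz': "z' = (i', s')" by (cases z')
      have "(i - i') * q = ((i * Q + j + s) div P - (i' * Q + j + s') div P) * p"
        using eq unfolding zz zz' g_def by (simp add: algebra_simps)
      then have "p dvd (i - i') * q" by (metis dvd_triv_right)
      then have "p dvd i - i'" using cop by (simp add: coprime_dvd_mult_left_iff)
      moreover have "\<bar>i - i'\<bar> < p" using z by (auto simp: zz zz' Z_def)
      ultimately have ii: "i = i'" by (rule dvd_diff_imp_eq)
      have "p * (c - j) - (p * s + i * \<kappa>) = p * (c - j) - (p * s' + i' * \<kappa>)"
        using key[of i s] key[of i' s'] z eq by (simp add: zz zz')
      then have "s = s'" using ii p by simp
      then show "z = z'" using ii by (simp add: zz zz')
    qed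
    \<comment> \<open>Both \<open>p * s\<close> and \<open>(i - a) * \<kappa>\<close> lie between 0
      and \<open>p * \<kappa>\<close>; they are subtracted, so the interval of width
      \<open>2 * p * \<bar>\<kappa>\<bar>\<close> extends downwards for
      \<open>\<kappa> \<ge> 0\<close> and upwards otherwise.\<close>
    define lo where "lo = p * (c - j) - a * \<kappa> - (if \<kappa> \<ge> 0 then 2 * p * \<kappa> else 0)"
    have "real (card (g ` Z)) \<le> (2 * of_int p * \<bar>of_int \<kappa>\<bar>) / of_int P + 1"
    proof (rule card_multiples_le[OF birkhoff_P, where lo="of_int lo"])
      show "0 \<le> 2 * real_of_int p * \<bar>of_int \<kappa>\<bar>" using p by simp
      fix m assume "m \<in> g ` Z"
      then obtain i s where im: "(i, s) \<in> Z" "m = g (i, s)" by auto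
      have i: "0 \<le> i - a" "i - a \<le> p" and s: "s \<in> I" using im(1) by (auto simp: Z_def)
      have Pm: "P * m = p * (c - j) - a * \<kappa> - (p * s + (i - a) * \<kappa>)"
        using key[OF im(1)] im(2) by (simp add: algebra_simps)
      have "lo \<le> P * m \<and> P * m \<le> lo + 2 * p * \<bar>\<kappa>\<bar>"
      proof (cases "\<kappa> \<ge> 0")
        case True
        then have "0 \<le> s" "s \<le> \<kappa>" using s by (auto simp: I_def)
        then have "0 \<le> p * s" "p * s \<le> p * \<kappa>" "0 \<le> (i - a) * \<kappa>" "(i - a) * \<kappa> \<le> p * \<kappa>"
          using i p True by (auto intro: mult_left_mono mult_right_mono)
        then show ?thesis using True unfolding Pm lo_def by (simp add: algebra_simps)
      next
        case False
        then have "s \<le> 0" "\<kappa> \<le> s" using s by (auto simp: I_def)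
        then have "p * s \<le> 0" "p * \<kappa> \<le> p * s" "(i - a) * \<kappa> \<le> 0" "p * \<kappa> \<le> (i - a) * \<kappa>"
          using i p False by (auto simp: mult_nonneg_nonpos intro: mult_left_mono mult_right_mono_neg)
        moreover have "2 * p * \<bar>\<kappa>\<bar> = - 2 * (p * \<kappa>)" "lo = p * (c - j) - a * \<kappa>"
          using False by (simp_all add: lo_def)
        ultimately show ?thesis unfolding Pm by linarith
      qed
      then have "real_of_int lo \<le> of_int (P * m) \<and> real_of_int (P * m) \<le> of_int (lo + 2 * p * \<bar>\<kappa>\<bar>)"
        by (simp only: of_int_le_iff)
      then show "real_of_int lo \<le> of_int P * of_int m \<and>
          of_int P * of_int m \<le> real_of_int lo + 2 * of_int p * \<bar>of_int \<kappa>\<bar>" by simp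
    qed
    then show "real (card {z \<in> {a..<a + p} \<times> I. (\<lambda>(i, s). i * Q + j + s) z mod P = c})
        \<le> 2 * of_int p * \<bar>of_int \<kappa>\<bar> / of_int P + 1"
      using card_image[OF inj] by (simp add: Z_def)
  qed
  finally show ?thesis .
qed

end

text \<open>Average over the \<open>p\<close> values of \<open>a\<close> for which
  \<open>{a..<a + p}\<close> contains 0. After exchanging the sums, each of the \<open>r\<close>
  offsets contributes the sum over one block of length \<open>p\<close>.\<close>

lemma pigeonhole_window:
  fixes \<eta> :: "int \<Rightarrow> real"
  assumes p: "p \<ge> 1" and blocks: "\<And>b. (\<Sum>i\<in>{b..<b + p}. \<eta> i) \<le> B"
  shows "\<exists>a. - p < a \<and> a \<le> 0 \<and> (\<Sum>i\<in>{a..<a + int r}. \<eta> i) \<le> real r * B / of_int p"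
proof (rule ccontr)
  assume no: "\<not> ?thesis"
  let ?A = "{- p + 1..<- p + 1 + p}"
  have "(\<Sum>a\<in>?A. real r * B / of_int p) < (\<Sum>a\<in>?A. \<Sum>i\<in>{a..<a + int r}. \<eta> i)"
  proof (rule sum_strict_mono)
    fix b assume "b \<in> ?A"
    then have "- p < b" "b \<le> 0" by auto
    then show "real r * B / of_int p < (\<Sum>i\<in>{b..<b + int r}. \<eta> i)" using no by (meson not_le)
  qed (use p in auto)
  moreover have "(\<Sum>a\<in>?A. real r * B / of_int p) = real r * B"
    using p by simp
  moreover have "(\<Sum>a\<in>?A. \<Sum>i\<in>{a..<a + int r}. \<eta> i) = (\<Sum>a\<in>?A. \<Sum>t\<in>{0..<int r}. \<eta> (t + a))"
    using sum_shift_int[of \<eta> 0 _ "int r"] by (simp add: add.commute)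
  moreover have "\<dots> = (\<Sum>t\<in>{0..<int r}. \<Sum>a\<in>?A. \<eta> (t + a))" by (rule sum.swap)
  moreover have "\<dots> \<le> (\<Sum>t\<in>{0..<int r}. B)"
  proof (rule sum_mono)
    fix t
    have "(\<Sum>a\<in>?A. \<eta> (t + a)) = (\<Sum>a\<in>{- p + 1 + t..<- p + 1 + p + t}. \<eta> a)"
      using sum_shift_int[of \<eta> "- p + 1" t "- p + 1 + p"] by (simp add: add.commute)
    then show "(\<Sum>a\<in>?A. \<eta> (t + a)) \<le> B"
      using blocks[of "- p + 1 + t"] by (simp add: ac_simps)
  qed
  ultimately show False by simp
qed

section \<open>Comparison of the barriers of two fractions\<close>

context monotone_potential
begin

lemma birkhoff_minimizer_fun:
  assumes "P \<ge> 1" "coprime P Q"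
  obtains h where "birkhoff_fun P h" "\<And>j. minimizer P Q (\<lambda>i. h (i * Q + j))"
  using birkhoff_minimizer[OF assms] assms(1) unfolding birkhoff_fun_def by blast

lemma birkhoff_steps:
  assumes h: "birkhoff_fun P h" and L: "\<bar>of_int Q / of_int P\<bar> \<le> L"
  shows "\<bar>h ((i + 1) * Q + j) - h (i * Q + j)\<bar> \<le> L + 1"
proof -
  have "\<bar>h (i * Q + j + Q) - h (i * Q + j)\<bar> \<le> \<bar>of_int Q\<bar> / of_int P + 1" by (rule birkhoff_dist[OF h])
  moreover have "\<bar>of_int Q\<bar> / of_int P = \<bar>of_int Q / of_int P :: real\<bar>"
    using birkhoff_P[OF h] by (simp add: abs_divide)
  ultimately show ?thesis using L by (simp add: algebra_simps)
qed

text \<open>Consecutive translates of the Birkhoff minimizer confine the constrained one. Their gaps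
  sum up to at most 1 over a period, and each of the \<open>r\<close> overhanging sites adds at most
  1, which bounds the barrier uniformly in the frequency.\<close>

lemma constrained_minimizer_steps:
  assumes P: "P \<ge> 1" and cop: "coprime P Q" and L: "\<bar>of_int Q / of_int P\<bar> \<le> L"
    and K: "lip_const D K" "L + 2 \<le> D"
  shows "\<exists>x\<in>periodic_seqs P Q. x 0 = \<xi> \<and> act x 0 P = cmin P Q \<xi> \<and> (\<forall>i. \<bar>x (i + 1) - x i\<bar> \<le> L + 2) \<and>
    peierls_pq r S P Q \<xi> \<le> K * (real r + 1)"
proof -
  obtain h where h: "birkhoff_fun P h" and min: "\<And>j. minimizer P Q (\<lambda>i. h (i * Q + j))"
    using birkhoff_minimizer_fun[OF P cop] by blast
  obtain j where j: "h j \<le> \<xi>" "\<xi> \<le> h (j + 1)" using birkhoff_bracket[OF h] by blast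
  define l where "l = (\<lambda>i. h (i * Q + j))"
  define u where "u = (\<lambda>i. h (i * Q + (j + 1)))"
  have lu: "l i \<le> u i" "u i \<le> l i + 1" for i
    using birkhoff_mono[OF h, of "i * Q + j" "i * Q + (j + 1)"] birkhoff_gap_le_1[OF h, of "i * Q + j"]
    by (simp_all add: l_def u_def ac_simps)
  have lm: "minimizer P Q l" and um: "minimizer P Q u" unfolding l_def u_def by (rule min)+
  have st: "\<bar>l (i + 1) - l i\<bar> \<le> L + 1" for i unfolding l_def by (rule birkhoff_steps[OF h L])
  obtain x where x: "x \<in> periodic_seqs P Q" "x 0 = \<xi>" "\<And>i. l i \<le> x i \<and> x i \<le> u i" "act x 0 P = cmin P Q \<xi>"
    using constrained_minimizer[OF P lm um lu(1)] j by (fastforce simp: l_def u_def)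
  have "\<bar>x (i + 1) - x i\<bar> \<le> L + 2" for i
    using steps_between[where l=l and u=u and x=x and c="L + 1" and i=i, OF st x(3) lu(2)] by simp
  moreover have "peierls_pq r S P Q \<xi> \<le> K * (real r + 1)"
  proof -
    have gap: "\<bar>l i - x i\<bar> \<le> u i - l i" for i using x(3)[of i] by linarith
    have L0: "L \<ge> 0" using L by linarith
    have "\<bar>act l 0 P - act x 0 P\<bar> \<le> K * (\<Sum>i\<in>{0..<P + int r}. \<bar>l i - x i\<bar>)"
    proof (rule act_lip[OF K(1)])
      fix i
      show "\<bar>l (i + 1) - l i\<bar> \<le> D" using st[of i] K(2) by linarith
      show "\<bar>l i - x i\<bar> \<le> D" using gap[of i] lu[of i] K(2) L0 by linarith
    qed (use P in simp)
    also have "\<dots> \<le> K * (real r + 1)"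
    proof (intro mult_left_mono lip_const_nonneg[OF K(1)])
      have "(\<Sum>i\<in>{0..<P}. \<bar>l i - x i\<bar>) \<le> (\<Sum>i\<in>{0..<0 + P}. h (i * Q + j + 1) - h (i * Q + j))"
        using gap by (auto intro!: sum_mono simp: l_def u_def add.assoc)
      also have "\<dots> \<le> 1" by (rule gap_sum_le_1[OF h cop]) simp
      finally have 1: "(\<Sum>i\<in>{0..<P}. \<bar>l i - x i\<bar>) \<le> 1" .
      have "(\<Sum>i\<in>{P..<P + int r}. \<bar>l i - x i\<bar>) \<le> (\<Sum>i\<in>{P..<P + int r}. 1)"
        by (rule sum_mono) (use gap lu(2) in \<open>smt (verit, best)\<close>)
      then have 2: "(\<Sum>i\<in>{P..<P + int r}. \<bar>l i - x i\<bar>) \<le> real r" by simp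
      have "(\<Sum>i\<in>{0..<P + int r}. \<bar>l i - x i\<bar>) = (\<Sum>i\<in>{0..<P}. \<bar>l i - x i\<bar>) + (\<Sum>i\<in>{P..<P + int r}. \<bar>l i - x i\<bar>)"
        by (rule sum_split) (use P in auto)
      then show "(\<Sum>i\<in>{0..<P + int r}. \<bar>l i - x i\<bar>) \<le> real r + 1" using 1 2 by linarith
    qed
    finally show ?thesis unfolding peierls_pq_eq wmin_eq[OF lm] x(4)[symmetric] by linarith
  qed
  ultimately show ?thesis using x by blast
qed

text \<open>The window lemmas are applied with \<open>N = 2 * P\<close>, \<open>M = 2 * Q\<close>
  and \<open>D = L + 10\<close>. Doubling leaves a complement of length at least
  \<open>P \<ge> r\<close>, even for \<open>p = P\<close>, and
  \<open>\<bar>\<kappa>\<bar> \<le> P\<close> keeps each drift at most 2.\<close>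

lemma compare_double:
  assumes P: "P \<ge> 1" and cop: "coprime P Q" "coprime p q" and L: "\<bar>of_int Q / of_int P\<bar> \<le> L" "\<bar>of_int q / of_int p\<bar> \<le> L"
    and p: "p \<ge> 1" "int r \<le> p" "p \<le> P" and \<kappa>: "\<kappa> = p * Q - q * P" "\<bar>\<kappa>\<bar> \<le> P"
    and K: "lip_const (L + 10) K"
  shows "\<bar>peierls_pq r S (2 * P) (2 * Q) \<xi> - peierls_pq r S p q \<xi>\<bar>
    \<le> 16 * K * real r * (1 / of_int p + \<bar>of_int \<kappa>\<bar> / of_int P)"
proof -
  obtain h where h: "birkhoff_fun P h" and min: "\<And>j. minimizer P Q (\<lambda>i. h (i * Q + j))"
    using birkhoff_minimizer_fun[OF P cop(1)] by blast
  obtain j where j: "h j \<le> \<xi>" "\<xi> \<le> h (j + 1)" using birkhoff_bracket[OF h] by blast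
  define l where "l = (\<lambda>i. h (i * Q + j))"
  define u where "u = (\<lambda>i. h (i * Q + (j + 1)))"
  have lu: "l i \<le> u i" "u i \<le> l i + 1" for i
    using birkhoff_mono[OF h, of "i * Q + j" "i * Q + (j + 1)"] birkhoff_gap_le_1[OF h, of "i * Q + j"]
    by (simp_all add: l_def u_def ac_simps)
  have lm: "minimizer (2 * P) (2 * Q) l" and um: "minimizer (2 * P) (2 * Q) u"
    using minimizer_mult[OF min P, of 2] by (simp_all add: l_def u_def)
  have st: "\<bar>l (i + 1) - l i\<bar> \<le> L + 10 - 8" "\<bar>u (i + 1) - u i\<bar> \<le> L + 10 - 8" for i
    using birkhoff_steps[OF h L(1), of i] by (simp_all add: l_def u_def) (smt (verit))+
  have drift: "h ((i + p) * Q + k) = h (i * Q + k + \<kappa>) + of_int q" for i k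
    using birkhoff_add_mult[OF h, of "i * Q + k + \<kappa>" q] by (simp add: \<kappa>(1) algebra_simps)
  have dd: "\<bar>h (i * Q + k) + of_int q - h ((i + p) * Q + k)\<bar> = \<bar>h (i * Q + k) - h (i * Q + k + \<kappa>)\<bar>" for i k
    unfolding drift by simp
  have d2: "\<bar>h (i * Q + k) + of_int q - h ((i + p) * Q + k)\<bar> \<le> 2" for i k
  proof -
    have "\<bar>of_int \<kappa>\<bar> / of_int P \<le> (1::real)" using \<kappa>(2) P by (simp add: divide_le_eq)
    then show ?thesis using birkhoff_dist[OF h, of "i * Q + k" \<kappa>] unfolding dd by linarith
  qed
  define \<eta> where "\<eta> i = (u i - l i) + (u (i + p) - l (i + p))
        + \<bar>l i + of_int q - l (i + p)\<bar> + \<bar>u i + of_int q - u (i + p)\<bar>" for i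
  \<comment> \<open>\<open>e\<close> bounds one drift sum over a block of length \<open>p\<close>;
    \<eta> consists of two gaps and two drifts.\<close>
  define e :: real where "e = 2 * of_int p * \<bar>of_int \<kappa>\<bar> / of_int P + 1"
  have blocks: "(\<Sum>i\<in>{b..<b + p}. \<eta> i) \<le> 2 + 2 * e" for b
  proof -
    have gap: "(\<Sum>i\<in>{c..<c + p}. u i - l i) \<le> 1" for c
      using gap_sum_le_1[where a=c and j=j, OF h cop(1) p(3)] by (simp add: u_def l_def add.assoc)
    have "(\<Sum>i\<in>{b..<b + p}. u (i + p) - l (i + p)) = (\<Sum>i\<in>{b + p..<b + p + p}. u i - l i)"
      using sum_shift_int[of "\<lambda>i. u i - l i" b p "b + p"] by simp
    moreover have "(\<Sum>i\<in>{b..<b + p}. \<bar>l i + of_int q - l (i + p)\<bar>) \<le> e"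
      unfolding l_def dd e_def by (rule drift_sum_le[OF h cop(2) p(1) \<kappa>(1)])
    moreover have "(\<Sum>i\<in>{b..<b + p}. \<bar>u i + of_int q - u (i + p)\<bar>) \<le> e"
      unfolding u_def dd e_def by (rule drift_sum_le[OF h cop(2) p(1) \<kappa>(1)])
    ultimately show ?thesis unfolding \<eta>_def sum.distrib using gap[of b] gap[of "b + p"] by linarith
  qed
  obtain a where a: "- p < a" "a \<le> 0" and Ha: "(\<Sum>i\<in>{a..<a + int r}. \<eta> i) \<le> real r * (2 + 2 * e) / of_int p"
    using pigeonhole_window[OF p(1) blocks, of r] by blast
  define H where "H = (\<Sum>i\<in>{a..<a + int r}. \<eta> i)"
  have "real r * (2 + 2 * e) / of_int p = 4 * real r * (1 / of_int p + \<bar>of_int \<kappa>\<bar> / of_int P)"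
    using p P by (simp add: e_def field_simps)
  then have H_le: "K * H \<le> K * (4 * real r * (1 / of_int p + \<bar>of_int \<kappa>\<bar> / of_int P))"
    using Ha lip_const_nonneg[OF K] by (intro mult_left_mono) (auto simp: H_def)
  have \<eta>0: "\<eta> i \<ge> 0" for i unfolding \<eta>_def using lu(1)[of i] lu(1)[of "i + p"] by simp
  have KH: "K * H \<ge> 0" unfolding H_def by (intro mult_nonneg_nonneg sum_nonneg \<eta>0 lip_const_nonneg[OF K])
  have Np: "1 \<le> 2 * P - p" "int r \<le> 2 * P - p" using p by linarith+
  have dl: "\<bar>l i + of_int q - l (i + p)\<bar> \<le> 2" and du: "\<bar>u i + of_int q - u (i + p)\<bar> \<le> 2" for i
    unfolding l_def u_def by (rule d2)+
  have Heq: "H = (\<Sum>i\<in>{a..<a + int r}. (u i - l i) + (u (i + p) - l (i + p))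
        + \<bar>l i + of_int q - l (i + p)\<bar> + \<bar>u i + of_int q - u (i + p)\<bar>)"
    by (simp add: H_def \<eta>_def)
  have \<xi>: "l 0 \<le> \<xi>" "\<xi> \<le> u 0" using j by (simp_all add: l_def u_def)
  obtain x where x: "x \<in> periodic_seqs p q" "x 0 = \<xi>" "act x 0 p = cmin p q \<xi>" "\<And>i. \<bar>x (i + 1) - x i\<bar> \<le> L + 2"
    using constrained_minimizer_steps[OF p(1) cop(2) L(2) K, of \<xi>] by auto
  have xs: "\<bar>x (i + 1) - x i\<bar> \<le> L + 10" for i using x(4)[of i] by linarith
  have "peierls_pq r S p q \<xi> \<le> peierls_pq r S (2 * P) (2 * Q) \<xi> + 3 * (K * H)"
    by (rule barrier_window_le[where l=l and u=u and q=q,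
        OF K p(1,2) Np a lm um lu st dl du Heq \<xi>])
  moreover have "peierls_pq r S (2 * P) (2 * Q) \<xi> \<le> peierls_pq r S p q \<xi> + 4 * (K * H)"
    by (rule barrier_le_window[where l=l and u=u and q=q and x=x,
        OF K p(1,2) Np a lm um lu st dl du Heq \<xi> x(1-3) xs])
  ultimately have "\<bar>peierls_pq r S (2 * P) (2 * Q) \<xi> - peierls_pq r S p q \<xi>\<bar> \<le> 4 * (K * H)"
    using KH by linarith
  also have "\<dots> \<le> 4 * (K * (4 * real r * (1 / of_int p + \<bar>of_int \<kappa>\<bar> / of_int P)))"
    using H_le by linarith
  also have "\<dots> = 16 * K * real r * (1 / of_int p + \<bar>of_int \<kappa>\<bar> / of_int P)" by simp
  finally show ?thesis .
qed

text \<open>For \<open>p \<le> P\<close> both barriers are compared with that of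
  \<open>(2 * P, 2 * Q)\<close>, unless \<open>p < r\<close> or
  \<open>\<bar>\<kappa>\<bar> > P\<close>; then the right-hand side is bounded below and the uniform
  bound \<open>B\<close> suffices. For \<open>p > P\<close> the roles are exchanged.\<close>

lemma rational_estimate:
  fixes L :: real
  assumes L: "L \<ge> 0"
  shows "\<exists>C\<ge>0. \<forall>P Q p q \<xi>. P \<ge> 1 \<longrightarrow> coprime P Q \<longrightarrow> p \<ge> 1 \<longrightarrow> coprime p q \<longrightarrow>
    \<bar>of_int Q / of_int P\<bar> \<le> L \<longrightarrow> \<bar>of_int q / of_int p\<bar> \<le> L \<longrightarrow>
    \<bar>peierls_pq r S P Q \<xi> - peierls_pq r S p q \<xi>\<bar> \<le> C * (1 / of_int p + \<bar>of_int p * (of_int Q / of_int P) - of_int q\<bar>)"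
proof -
  obtain K where K: "lip_const (L + 10) K" using lip_const_exists[of "L + 10"] L by auto
  have K0: "K \<ge> 0" by (rule lip_const_nonneg[OF K])
  define B where "B = K * (real r + 1)"
  have B0: "B \<ge> 0" using K0 by (simp add: B_def)
  have bound: "0 \<le> peierls_pq r S P Q \<xi> \<and> peierls_pq r S P Q \<xi> \<le> B"
    if "P \<ge> 1" "coprime P Q" "\<bar>of_int Q / of_int P\<bar> \<le> L" for P Q \<xi>
    using constrained_minimizer_steps[OF that K] wmin_le_cmin[OF that(1), of Q \<xi>]
    by (auto simp: peierls_pq_eq B_def)
  have trivial: "\<bar>peierls_pq r S P Q \<xi> - peierls_pq r S p q \<xi>\<bar> \<le> B"
    if "P \<ge> 1" "coprime P Q" "\<bar>of_int Q / of_int P\<bar> \<le> L" "p \<ge> 1" "coprime p q" "\<bar>of_int q / of_int p\<bar> \<le> L"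
    for P Q p q \<xi>
    using bound[OF that(1-3), of \<xi>] bound[OF that(4-6), of \<xi>] by linarith
  \<comment> \<open>The first summand serves the cases settled by \<open>B\<close>, the second one
    two comparisons with factor 16.\<close>
  define C where "C = B * (real r + 1) + 32 * K * real r"
  have BC: "B \<le> C" "B * real r \<le> C" "32 * K * real r \<le> C" using B0 K0 by (auto simp: C_def algebra_simps)
  have C0: "C \<ge> 0" using BC(1) B0 by linarith
  have eps: "\<bar>of_int p * (of_int Q / of_int P) - of_int q :: real\<bar> = \<bar>of_int (p * Q - q * P)\<bar> / of_int P"
    if "P \<ge> 1" for p q P Q :: int
  proof -
    have "of_int p * (of_int Q / of_int P) - of_int q = (of_int (p * Q - q * P) / of_int P :: real)"
      using that by (simp add: field_simps)
    then show ?thesis using that by (simp add: abs_divide)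
  qed
  have small: "\<bar>peierls_pq r S P Q \<xi> - peierls_pq r S p q \<xi>\<bar> \<le> C * (1 / of_int p + \<bar>of_int (p * Q - q * P)\<bar> / of_int P)"
    if PQ: "P \<ge> 1" "coprime P Q" "\<bar>of_int Q / of_int P\<bar> \<le> L" and pq: "p \<ge> 1" "coprime p q" "\<bar>of_int q / of_int p\<bar> \<le> L"
      and le: "p \<le> P" for P Q p q \<xi>
  proof -
    let ?\<kappa> = "p * Q - q * P"
    let ?e = "\<bar>of_int ?\<kappa>\<bar> / of_int P :: real"
    have e0: "?e \<ge> 0" using PQ(1) by simp
    have p0: "1 / real_of_int p \<ge> 0" using pq(1) by simp
    consider "p < int r" | "P < \<bar>?\<kappa>\<bar>" | "int r \<le> p" "\<bar>?\<kappa>\<bar> \<le> P" by linarith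
    then show ?thesis
    proof cases
      case 1
      have "B * 1 \<le> B * (real r * (1 / of_int p))"
        by (intro mult_left_mono B0) (use 1 pq(1) in \<open>simp add: le_divide_eq\<close>)
      also have "\<dots> = B * real r * (1 / of_int p)" by simp
      also have "\<dots> \<le> C * (1 / of_int p)" by (intro mult_right_mono BC p0)
      also have "\<dots> \<le> C * (1 / of_int p + ?e)" by (intro mult_left_mono C0) (use e0 in simp)
      finally show ?thesis using trivial[OF PQ pq, of \<xi>] by linarith
    next
      case 2
      have "real_of_int P \<le> \<bar>of_int ?\<kappa>\<bar>" using 2 by linarith
      then have "1 \<le> ?e" using PQ(1) by (simp add: le_divide_eq)
      then have "B * 1 \<le> C * (1 / of_int p + ?e)"
        by (intro mult_mono BC C0) (use p0 \<open>1 \<le> ?e\<close> in \<open>linarith+\<close>)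
      then show ?thesis using trivial[OF PQ pq, of \<xi>] by linarith
    next
      case 3
      have 1: "\<bar>peierls_pq r S (2 * P) (2 * Q) \<xi> - peierls_pq r S p q \<xi>\<bar> \<le> 16 * K * real r * (1 / of_int p + ?e)"
        by (rule compare_double[OF PQ(1,2) pq(2) PQ(3) pq(3) pq(1) 3(1) le refl 3(2) K])
      \<comment> \<open>The constraint is imposed once per period, so the barriers of
        \<open>(2 * P, 2 * Q)\<close> and \<open>(P, Q)\<close> are a priori different. They are
        compared by the same lemma, with a window of length \<open>P\<close> and \<kappa> =
        0.\<close>
      have "\<bar>peierls_pq r S (2 * P) (2 * Q) \<xi> - peierls_pq r S P Q \<xi>\<bar> \<le> 16 * K * real r * (1 / of_int P + \<bar>of_int (P * Q - Q * P)\<bar> / of_int P)"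
        by (rule compare_double[OF PQ(1,2,2,3,3,1)]) (use 3 le PQ(1) K in \<open>auto simp: mult.commute\<close>)
      also have "\<dots> = 16 * K * real r * (1 / of_int P)" by (simp add: mult.commute)
      also have "\<dots> \<le> 16 * K * real r * (1 / of_int p + ?e)"
      proof (intro mult_left_mono)
        have "1 / real_of_int P \<le> 1 / of_int p" using le pq(1) by (intro divide_left_mono) auto
        then show "1 / real_of_int P \<le> 1 / of_int p + ?e" using e0 by linarith
      qed (use K0 in simp)
      finally have "\<bar>peierls_pq r S P Q \<xi> - peierls_pq r S p q \<xi>\<bar> \<le> 32 * K * real r * (1 / of_int p + ?e)"
        using 1 by linarith
      also have "\<dots> \<le> C * (1 / of_int p + ?e)"
        by (intro mult_right_mono BC) (use e0 p0 in linarith)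
      finally show ?thesis .
    qed
  qed
  have "\<bar>peierls_pq r S P Q \<xi> - peierls_pq r S p q \<xi>\<bar> \<le> 2 * C * (1 / of_int p + \<bar>of_int p * (of_int Q / of_int P) - of_int q\<bar>)"
    if PQ: "P \<ge> 1" "coprime P Q" "\<bar>of_int Q / of_int P\<bar> \<le> L" and pq: "p \<ge> 1" "coprime p q" "\<bar>of_int q / of_int p\<bar> \<le> L"
    for P Q p q \<xi>
  proof -
    let ?e = "\<bar>of_int (p * Q - q * P)\<bar> / of_int P :: real"
    have e0: "?e \<ge> 0" and p0: "1 / real_of_int p \<ge> 0" using PQ(1) pq(1) by simp_all
    show ?thesis unfolding eps[OF PQ(1)]
    proof (cases "p \<le> P")
      case True
      have "C * (1 / of_int p + ?e) \<ge> 0" using C0 e0 p0 by simp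
      then show "\<bar>peierls_pq r S P Q \<xi> - peierls_pq r S p q \<xi>\<bar> \<le> 2 * C * (1 / of_int p + ?e)"
        using small[OF PQ pq True, of \<xi>] by (simp only: mult.assoc) linarith
    next
      case False
      \<comment> \<open>The fractions differ, because both are in lowest terms and
        \<open>p > P\<close>. Hence \<open>\<bar>\<kappa>\<bar> \<ge> 1\<close>, and both
        \<open>1 / P\<close> and \<open>\<bar>\<kappa>\<bar> / p\<close> are at most
        \<open>\<bar>\<kappa>\<bar> / P\<close>.\<close>
      have "p * Q \<noteq> q * P"
      proof
        assume "p * Q = q * P"
        then have "p dvd q * P" by (metis dvd_triv_left)
        then have "p dvd P" using pq(2) by (simp add: coprime_dvd_mult_right_iff)
        then show False using zdvd_imp_le[of p P] PQ(1) False by simp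
      qed
      then have k1: "1 \<le> \<bar>of_int (p * Q - q * P) :: real\<bar>" by linarith
      have "\<bar>peierls_pq r S p q \<xi> - peierls_pq r S P Q \<xi>\<bar> \<le> C * (1 / of_int P + \<bar>of_int (P * q - Q * p)\<bar> / of_int p)"
        by (rule small[OF pq PQ]) (use False in simp)
      also have "\<dots> \<le> C * (?e + ?e)"
      proof (intro mult_left_mono C0 add_mono)
        show "1 / real_of_int P \<le> ?e" by (rule divide_right_mono[OF k1]) (use PQ(1) in simp)
        have "\<bar>of_int (P * q - Q * p)\<bar> = \<bar>of_int (p * Q - q * P) :: real\<bar>"
          by (simp add: mult.commute abs_minus_commute)
        then show "\<bar>of_int (P * q - Q * p)\<bar> / real_of_int p \<le> ?e"
          using False PQ(1) by (simp only:) (intro divide_left_mono, auto)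
      qed
      also have "\<dots> \<le> 2 * C * (1 / of_int p + ?e)"
        using C0 p0 by (simp add: algebra_simps)
      finally show "\<bar>peierls_pq r S P Q \<xi> - peierls_pq r S p q \<xi>\<bar> \<le> 2 * C * (1 / of_int p + ?e)"
        by linarith
    qed
  qed
  moreover have "2 * C \<ge> 0" using C0 by simp
  ultimately show ?thesis by blast
qed

end

section \<open>Irrational frequencies\<close>

text \<open>Dirichlet's theorem bounds the denominator from above only. To make it large, the error
  is required to be smaller than \<mu>, which is at most the distance of \<open>k * \<omega>\<close>
  to the integers for every \<open>k \<le> M\<close> and positive by irrationality.\<close>

lemma irrational_approximation:
  fixes \<omega> :: real
  assumes irr: "\<omega> \<notin> \<rat>" and \<delta>: "\<delta> > 0"
  obtains p q :: int where "p \<ge> 1" "coprime p q" "1 / of_int p < \<delta>" "\<bar>of_int p * \<omega> - of_int q\<bar> < \<delta>"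
proof -
  obtain M :: nat where M: "1 / \<delta> < real M" using reals_Archimedean2 by blast
  define D where "D k = \<bar>of_int k * \<omega> - of_int (round (of_int k * \<omega>))\<bar>" for k :: int
  define \<mu> where "\<mu> = Min (insert \<delta> (D ` {1..int M}))"
  have "D k > 0" if "k \<ge> 1" for k
  proof -
    have "of_int k * \<omega> \<noteq> of_int m" for m :: int
    proof
      assume "of_int k * \<omega> = of_int m"
      then have "\<omega> = of_int m / of_int k" using that by (simp add: field_simps)
      then show False using irr by simp
    qed
    then show ?thesis by (simp add: D_def)
  qed
  then have \<mu>0: "\<mu> > 0" using \<delta> by (simp add: \<mu>_def)
  have \<mu>_le: "\<mu> \<le> \<delta>" "\<And>k. k \<in> {1..int M} \<Longrightarrow> \<mu> \<le> D k"
    unfolding \<mu>_def by (rule Min_le; auto)+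
  obtain N :: nat where N: "1 / \<mu> < real N" using reals_Archimedean2 by blast
  have N0: "N > 0" using N \<mu>0 by (metis divide_pos_pos gr0I less_asym of_nat_0 zero_less_one)
  then have N': "1 / real N < \<mu>" using N \<mu>0 by (simp add: field_simps)
  obtain h k where hk: "coprime h k" "0 < k" "\<bar>of_int k * \<omega> - of_int h\<bar> < 1 / real N"
    using Dirichlet_approx_coprime[OF N0, of \<omega>] by metis
  have "D k \<le> \<bar>of_int k * \<omega> - of_int h\<bar>" unfolding D_def by (rule round_diff_minimal)
  then have "k \<notin> {1..int M}" using \<mu>_le(2)[of k] hk(3) N' by linarith
  then have "real M < of_int k" using hk(2) by auto
  then have "1 / \<delta> < of_int k" using M by linarith
  then have "1 / of_int k < \<delta>" using hk(2) \<delta> by (simp add: field_simps)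
  then show thesis using that[of k h] hk N' \<mu>_le(1) by (simp add: coprime_commute)
qed

text \<open>Used for the values at rational points near an irrational \<open>\<omega>\<close>, where it gives the Cauchy
  property, and at real points, where it gives continuity.\<close>

lemma rational_comparison_imp_Cauchy:
  fixes f pos :: "'a \<Rightarrow> real" and B :: "int \<Rightarrow> int \<Rightarrow> real"
  assumes irr: "\<omega> \<notin> \<rat>" and C: "C \<ge> 0" and e: "e > 0"
    and cmp: "\<And>s p q. p \<ge> 1 \<Longrightarrow> coprime p q \<Longrightarrow> \<bar>pos s\<bar> \<le> 1 + \<bar>\<omega>\<bar> \<Longrightarrow> \<bar>of_int q / of_int p\<bar> \<le> 1 + \<bar>\<omega>\<bar> \<Longrightarrow>
      \<bar>f s - B p q\<bar> \<le> C * (1 / of_int p + \<bar>of_int p * pos s - of_int q\<bar>)"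
  shows "\<exists>d>0. \<forall>s t. \<bar>pos s - \<omega>\<bar> < d \<longrightarrow> \<bar>pos t - \<omega>\<bar> < d \<longrightarrow> \<bar>f s - f t\<bar> < e"
proof -
  \<comment> \<open>Each of two values is within \<open>3 * C * \<delta>\<close> of
    \<open>B p q\<close>; \<open>C + 1\<close> makes the final inequality strict and covers
    \<open>C = 0\<close>.\<close>
  define \<delta> where "\<delta> = min 1 (e / (6 * (C + 1)))"
  have \<delta>: "\<delta> > 0" "\<delta> \<le> 1" "\<delta> \<le> e / (6 * (C + 1))" using e C by (simp_all add: \<delta>_def)
  then have \<delta>e: "\<delta> * (6 * (C + 1)) \<le> e" using C by (subst (asm) pos_le_divide_eq) auto
  obtain p q where pq: "p \<ge> 1" "coprime p q" "1 / of_int p < \<delta>" "\<bar>of_int p * \<omega> - of_int q\<bar> < \<delta>"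
    using irrational_approximation[OF irr \<delta>(1)] by blast
  have qp: "\<bar>of_int q / of_int p\<bar> \<le> 1 + \<bar>\<omega>\<bar>"
  proof -
    have "\<bar>of_int p * (\<omega> - of_int q / of_int p)\<bar> < 1" using pq \<delta> by (simp add: algebra_simps)
    moreover have "\<bar>\<omega> - of_int q / of_int p\<bar> \<le> \<bar>of_int p * (\<omega> - of_int q / of_int p)\<bar>"
      using pq(1) mult_right_mono[of 1 "real_of_int p" "\<bar>\<omega> - of_int q / of_int p\<bar>"] by (simp add: abs_mult)
    ultimately show ?thesis by linarith
  qed
  \<comment> \<open>Moving \<open>pos s\<close> by \<open>d\<close> moves \<open>p * pos s\<close>
    by \<delta>, comparable with the other two errors.\<close>
  define d where "d = \<delta> / of_int p"
  have d: "d > 0" "d \<le> 1" using \<delta> pq(1) by (auto simp: d_def divide_le_eq)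
  have near: "\<bar>f s - B p q\<bar> \<le> C * (3 * \<delta>)" if s: "\<bar>pos s - \<omega>\<bar> < d" for s
  proof -
    have "\<bar>f s - B p q\<bar> \<le> C * (1 / of_int p + \<bar>of_int p * pos s - of_int q\<bar>)"
      by (rule cmp[OF pq(1,2) _ qp]) (use s d in linarith)
    also have "\<dots> \<le> C * (3 * \<delta>)"
    proof (rule mult_left_mono[OF _ C])
      have "\<bar>of_int p * (pos s - \<omega>)\<bar> \<le> of_int p * d"
        using s pq(1) by (simp add: abs_mult)
      then have "\<bar>of_int p * pos s - of_int p * \<omega>\<bar> \<le> \<delta>" using pq(1) by (simp add: d_def algebra_simps)
      then show "1 / of_int p + \<bar>of_int p * pos s - of_int q\<bar> \<le> 3 * \<delta>" using pq(3,4) by linarith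
    qed
    finally show ?thesis .
  qed
  have "\<bar>f s - f t\<bar> < e" if "\<bar>pos s - \<omega>\<bar> < d" "\<bar>pos t - \<omega>\<bar> < d" for s t
    using near[OF that(1)] near[OF that(2)] \<delta>(1) \<delta>e by (simp add: algebra_simps)
  then show ?thesis using d(1) by blast
qed

text \<open>With \<open>x = \<bar>\<omega> - \<Omega>\<bar>\<close>, take a Dirichlet approximation
  with \<open>N\<close> of order \<open>x powr (- 1 / 2)\<close>. The Diophantine condition forces
  \<open>p\<close> to be at least \<open>(\<gamma> * N) powr (1 / \<tau>)\<close>, while
  \<open>p * x \<le> N * x\<close> is of order \<open>x powr (1 / 2)\<close>; the former yields the
  exponent \<open>1 / (2 * \<tau>)\<close>.\<close>

lemma holder_of_diophantine:
  fixes g :: "real \<Rightarrow> real" and B :: "int \<Rightarrow> int \<Rightarrow> real"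
  assumes dioph: "diophantine \<omega>" and C: "C \<ge> 0"
    and cmp: "\<And>\<Omega> p q. p \<ge> 1 \<Longrightarrow> coprime p q \<Longrightarrow> \<bar>\<Omega>\<bar> \<le> 1 + \<bar>\<omega>\<bar> \<Longrightarrow> \<bar>of_int q / of_int p\<bar> \<le> 1 + \<bar>\<omega>\<bar> \<Longrightarrow>
      \<bar>g \<Omega> - B p q\<bar> \<le> C * (1 / of_int p + \<bar>of_int p * \<Omega> - of_int q\<bar>)"
  shows "holder_continuous_at g \<omega>"
proof -
  obtain \<gamma> \<tau> where \<gamma>: "\<gamma> > 0" and \<tau>: "\<tau> \<ge> 1"
    and dio: "\<And>p q :: int. p \<noteq> 0 \<Longrightarrow> \<bar>of_int p * \<omega> - of_int q\<bar> \<ge> \<gamma> / \<bar>of_int p\<bar> powr \<tau>"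
    using dioph unfolding diophantine_def by blast
  define \<alpha> where "\<alpha> = 1 / (2 * \<tau>)"
  \<comment> \<open>The term \<open>2 / p\<close> gives the part with \<gamma>. The two
    approximation errors are at most \<open>y\<close> and \<open>3 * y\<close>, which gives the 4;
    the final 1 makes \<open>c\<close> positive.\<close>
  define c where "c = C * (2 * \<gamma> powr (- 1 / \<tau>) + 4) + 1"
  have \<alpha>: "\<alpha> > 0" "\<alpha> \<le> 1 / 2" using \<tau> by (auto simp: \<alpha>_def field_simps)
  have c: "c > 0" using C by (simp add: c_def add_nonneg_pos)
  have "\<bar>g \<omega> - g \<Omega>\<bar> \<le> c * \<bar>\<omega> - \<Omega>\<bar> powr \<alpha>" if close: "\<bar>\<omega> - \<Omega>\<bar> \<le> 1" for \<Omega>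
  proof (cases "\<omega> = \<Omega>")
    case True
    then show ?thesis by simp
  next
    case False
    define x where "x = \<bar>\<omega> - \<Omega>\<bar>"
    have x: "x > 0" "x \<le> 1" using False close by (auto simp: x_def)
    define y where "y = x powr (1 / 2)"
    have y: "y > 0" "y \<le> 1" and yy: "y * y = x" using x by (auto simp: y_def powr_le1 powr_add[symmetric])
    define N where "N = nat \<lceil>1 / y\<rceil>"
    have Nlo: "1 / y \<le> real N" unfolding N_def by linarith
    have "real N < 1 / y + 1" unfolding N_def using y(1) by (simp add: of_nat_nat) linarith
    moreover have "1 \<le> 1 / y" using y by simp
    ultimately have Nhi: "real N \<le> 2 / y" by simp
    have N0: "N > 0" using Nlo \<open>1 \<le> 1 / y\<close> by linarith
    have N1: "1 / real N \<le> y" using Nlo y(1) N0 by (simp add: field_simps)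
    have N2: "real N * x \<le> 2 * y" using Nhi y(1) unfolding yy[symmetric] by (simp add: field_simps)
    obtain q p where pq: "coprime q p" "0 < p" "p \<le> int N" "\<bar>of_int p * \<omega> - of_int q\<bar> < 1 / real N"
      using Dirichlet_approx_coprime[OF N0, of \<omega>] by metis
    have p1: "p \<ge> 1" "coprime p q" using pq by (auto simp: coprime_commute)
    have "\<gamma> / of_int p powr \<tau> < 1 / real N" using dio[of p q] pq(2,4) by simp
    then have "\<gamma> * real N < of_int p powr \<tau>" using pq(2) N0 by (simp add: field_simps)
    then have "\<gamma> * (1 / y) \<le> of_int p powr \<tau>" using mult_left_mono[OF Nlo, of \<gamma>] \<gamma> by linarith
    then have "(\<gamma> * (1 / y)) powr (1 / \<tau>) \<le> (of_int p powr \<tau>) powr (1 / \<tau>)"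
      using \<gamma> y(1) \<tau> by (intro powr_mono2) auto
    also have "\<dots> = of_int p" using \<tau> pq(2) by (simp add: powr_powr)
    finally have "1 / of_int p \<le> 1 / (\<gamma> * (1 / y)) powr (1 / \<tau>)"
      using \<gamma> y(1) pq(2) by (intro divide_left_mono) auto
    also have "\<dots> = \<gamma> powr (- 1 / \<tau>) * y powr (1 / \<tau>)"
      using \<gamma> y(1) by (simp add: powr_mult powr_divide powr_minus_divide)
    also have "y powr (1 / \<tau>) = x powr \<alpha>" by (simp add: y_def \<alpha>_def powr_powr)
    finally have p2: "1 / of_int p \<le> \<gamma> powr (- 1 / \<tau>) * x powr \<alpha>" .
    \<comment> \<open>As \<open>x \<le> 1\<close> and \<open>\<alpha> \<le> 1 / 2\<close>, the
      smaller exponent dominates.\<close>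
    have yx: "y \<le> x powr \<alpha>" unfolding y_def using x \<alpha> by (intro powr_mono') auto
    have qp: "\<bar>of_int q / of_int p\<bar> \<le> 1 + \<bar>\<omega>\<bar>"
    proof -
      have "1 / real N \<le> 1" using N0 by simp
      then have "\<bar>of_int p * (\<omega> - of_int q / of_int p)\<bar> < 1" using pq(2,4) by (simp add: algebra_simps)
      moreover have "\<bar>\<omega> - of_int q / of_int p\<bar> \<le> \<bar>of_int p * (\<omega> - of_int q / of_int p)\<bar>"
        using p1(1) mult_right_mono[of 1 "real_of_int p" "\<bar>\<omega> - of_int q / of_int p\<bar>"] by (simp add: abs_mult)
      ultimately show ?thesis by linarith
    qed
    have "\<bar>of_int p * \<omega> - of_int p * \<Omega>\<bar> = of_int p * x"
      using pq(2) by (simp add: x_def abs_mult right_diff_distrib[symmetric])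
    also have "\<dots> \<le> real N * x" using pq(3) x(1) by (intro mult_right_mono) auto
    finally have pd: "\<bar>of_int p * \<omega> - of_int p * \<Omega>\<bar> \<le> 2 * y" using N2 by linarith
    have "\<bar>g \<omega> - g \<Omega>\<bar> \<le> C * (1 / of_int p + \<bar>of_int p * \<omega> - of_int q\<bar>) + C * (1 / of_int p + \<bar>of_int p * \<Omega> - of_int q\<bar>)"
      using cmp[OF p1 _ qp, of \<omega>] cmp[OF p1 _ qp, of \<Omega>] close by linarith
    also have "\<dots> = C * (2 / of_int p + (\<bar>of_int p * \<omega> - of_int q\<bar> + \<bar>of_int p * \<Omega> - of_int q\<bar>))"
      by (simp add: algebra_simps)
    also have "\<dots> \<le> C * (2 * (\<gamma> powr (- 1 / \<tau>) * x powr \<alpha>) + 4 * x powr \<alpha>)"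
    proof (rule mult_left_mono[OF _ C])
      have "2 / real_of_int p = 2 * (1 / of_int p)" by simp
      then show "2 / of_int p + (\<bar>of_int p * \<omega> - of_int q\<bar> + \<bar>of_int p * \<Omega> - of_int q\<bar>)
          \<le> 2 * (\<gamma> powr (- 1 / \<tau>) * x powr \<alpha>) + 4 * x powr \<alpha>"
        using p2 pq(4) pd N1 yx by linarith
    qed
    also have "\<dots> = (c - 1) * x powr \<alpha>" by (simp add: c_def algebra_simps)
    also have "\<dots> \<le> c * x powr \<alpha>" by (intro mult_right_mono) auto
    finally show ?thesis by (simp add: x_def)
  qed
  then show ?thesis unfolding holder_continuous_at_def using c \<alpha>(1) by (meson zero_less_one)
qed

section \<open>Limits along the rationals\<close>

lemma rat_filter_neq_bot: "filtercomap of_rat (nhds (\<omega>::real)) \<noteq> bot"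
  unfolding trivial_limit_def
proof
  assume "eventually (\<lambda>_. False) (filtercomap of_rat (nhds \<omega>))"
  then obtain Q where Q: "eventually Q (nhds \<omega>)" "\<And>s. \<not> Q (of_rat s)"
    by (auto simp: eventually_filtercomap)
  then obtain d where d: "d > 0" "\<And>x. dist x \<omega> < d \<Longrightarrow> Q x" by (auto simp: eventually_nhds_metric)
  obtain s where "\<omega> < of_rat s" "of_rat s < \<omega> + d" using of_rat_dense[of \<omega> "\<omega> + d"] d(1) by auto
  then show False using d(2)[of "of_rat s"] Q(2)[of s] by (simp add: dist_real_def)
qed

lemma tendsto_of_rat: "(of_rat \<longlongrightarrow> \<omega>) (filtercomap of_rat (nhds (\<omega>::real)))"
  by (rule filterlim_filtercomap)

text \<open>A sequence of rationals converging to \<omega> supplies the limit by completeness; the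
  Cauchy property then carries it over to all rationals near \<omega>.\<close>

lemma rat_filter_convergent:
  fixes f :: "rat \<Rightarrow> real" and \<omega> :: real
  assumes cauchy: "\<And>e. e > 0 \<Longrightarrow> \<exists>d>0. \<forall>s t. \<bar>of_rat s - \<omega>\<bar> < d \<longrightarrow> \<bar>of_rat t - \<omega>\<bar> < d \<longrightarrow> \<bar>f s - f t\<bar> < e"
  shows "\<exists>l. (f \<longlongrightarrow> l) (filtercomap of_rat (nhds \<omega>))"
proof -
  have "\<exists>s. \<bar>of_rat s - \<omega>\<bar> < 1 / real (Suc n)" for n
  proof -
    obtain s where "\<omega> < of_rat s" "of_rat s < \<omega> + 1 / real (Suc n)"
      using of_rat_dense[of \<omega> "\<omega> + 1 / real (Suc n)"] by auto
    then have "\<bar>of_rat s - \<omega>\<bar> < 1 / real (Suc n)" by linarith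
    then show ?thesis by blast
  qed
  then obtain \<sigma> where \<sigma>: "\<And>n. \<bar>of_rat (\<sigma> n) - \<omega>\<bar> < 1 / real (Suc n)" by metis
  have near: "\<exists>M. \<forall>n\<ge>M. \<bar>of_rat (\<sigma> n) - \<omega>\<bar> < d" if d0: "d > 0" for d :: real
  proof -
    obtain M where M: "1 / real (Suc M) < d" using nat_approx_posE[OF d0] by blast
    have "\<bar>of_rat (\<sigma> n) - \<omega>\<bar> < d" if "n \<ge> M" for n
    proof -
      have "1 / real (Suc n) \<le> 1 / real (Suc M)" using that by (intro divide_left_mono) auto
      then show ?thesis using \<sigma>[of n] M by linarith
    qed
    then show ?thesis by blast
  qed
  have "Cauchy (\<lambda>n. f (\<sigma> n))"
  proof (rule metric_CauchyI)
    fix e :: real assume "e > 0"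
    then obtain d where d: "d > 0" "\<And>s t. \<bar>of_rat s - \<omega>\<bar> < d \<Longrightarrow> \<bar>of_rat t - \<omega>\<bar> < d \<Longrightarrow> \<bar>f s - f t\<bar> < e"
      using cauchy by blast
    obtain M where "\<And>n. n \<ge> M \<Longrightarrow> \<bar>of_rat (\<sigma> n) - \<omega>\<bar> < d" using near[OF d(1)] by blast
    then show "\<exists>M. \<forall>m\<ge>M. \<forall>n\<ge>M. dist (f (\<sigma> m)) (f (\<sigma> n)) < e"
      using d(2) unfolding dist_real_def by blast
  qed
  then obtain l where l: "(\<lambda>n. f (\<sigma> n)) \<longlonglongrightarrow> l" using Cauchy_convergent convergentD by blast
  have "(f \<longlongrightarrow> l) (filtercomap of_rat (nhds \<omega>))"
  proof (rule tendstoI)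
    fix e :: real assume e: "e > 0"
    then obtain d where d: "d > 0" "\<And>s t. \<bar>of_rat s - \<omega>\<bar> < d \<Longrightarrow> \<bar>of_rat t - \<omega>\<bar> < d \<Longrightarrow> \<bar>f s - f t\<bar> < e / 2"
      using cauchy[of "e / 2"] by auto
    obtain M where M: "\<And>n. n \<ge> M \<Longrightarrow> \<bar>of_rat (\<sigma> n) - \<omega>\<bar> < d" using near[OF d(1)] by blast
    obtain M' where M': "\<And>n. n \<ge> M' \<Longrightarrow> \<bar>f (\<sigma> n) - l\<bar> < e / 2"
      using LIMSEQ_D[OF l, of "e / 2"] e by auto
    have "\<bar>f s - l\<bar> < e" if "\<bar>of_rat s - \<omega>\<bar> < d" for s
      using d(2)[OF that M[of "max M M'"]] M'[of "max M M'"] by linarith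
    moreover have "eventually (\<lambda>s. dist (of_rat s) \<omega> < d) (filtercomap of_rat (nhds \<omega>))"
      by (rule tendstoD[OF tendsto_of_rat d(1)])
    ultimately show "eventually (\<lambda>s. dist (f s) l < e) (filtercomap of_rat (nhds \<omega>))"
      by (auto simp: dist_real_def elim: eventually_mono)
  qed
  then show ?thesis by blast
qed

context monotone_potential
begin

lemma peierls_rat_estimate:
  fixes L :: real
  assumes L: "L \<ge> 0"
  shows "\<exists>C\<ge>0. \<forall>s p q \<xi>. p \<ge> 1 \<longrightarrow> coprime p q \<longrightarrow> \<bar>of_rat s\<bar> \<le> L \<longrightarrow> \<bar>of_int q / of_int p\<bar> \<le> L \<longrightarrow>
    \<bar>peierls_rat r S s \<xi> - peierls_pq r S p q \<xi>\<bar> \<le> C * (1 / of_int p + \<bar>of_int p * of_rat s - of_int q\<bar>)"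
proof -
  obtain C where C: "C \<ge> 0" and est: "\<And>P Q p q \<xi>. P \<ge> 1 \<Longrightarrow> coprime P Q \<Longrightarrow> p \<ge> 1 \<Longrightarrow> coprime p q \<Longrightarrow>
    \<bar>of_int Q / of_int P\<bar> \<le> L \<Longrightarrow> \<bar>of_int q / of_int p\<bar> \<le> L \<Longrightarrow>
    \<bar>peierls_pq r S P Q \<xi> - peierls_pq r S p q \<xi>\<bar> \<le> C * (1 / of_int p + \<bar>of_int p * (of_int Q / of_int P) - of_int q\<bar>)"
    using rational_estimate[OF L] by blast
  have "\<bar>peierls_rat r S s \<xi> - peierls_pq r S p q \<xi>\<bar> \<le> C * (1 / of_int p + \<bar>of_int p * of_rat s - of_int q\<bar>)"
    if "p \<ge> 1" "coprime p q" "\<bar>of_rat s\<bar> \<le> L" "\<bar>of_int q / of_int p\<bar> \<le> L" for s p q \<xi>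
  proof -
    obtain Q P where QP: "quotient_of s = (Q, P)" by (cases "quotient_of s")
    have P: "P \<ge> 1" "coprime P Q"
      using quotient_of_denom_pos[OF QP] quotient_of_coprime[OF QP] by (auto simp: coprime_commute)
    have s: "of_rat s = (of_int Q / of_int P :: real)"
      using quotient_of_div[OF QP] by (simp add: of_rat_divide)
    show ?thesis using est[OF P that(1,2) _ that(4)] that(3) by (simp add: s peierls_rat_def QP)
  qed
  then show ?thesis using C by blast
qed

lemma peierls_of_rat: "peierls r S (of_rat s) \<xi> = peierls_rat r S s \<xi>"
  by (simp add: peierls_def)

text \<open>The uniform rational estimate gives the Cauchy property, so the \<open>Lim\<close> in
  the definition of \<open>peierls\<close> is a genuine limit and not a default value.\<close>

lemma peierls_limit:
  assumes irr: "\<omega> \<notin> \<rat>"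
  shows "((\<lambda>s. peierls_rat r S s \<xi>) \<longlongrightarrow> peierls r S \<omega> \<xi>) (filtercomap of_rat (nhds \<omega>))"
proof -
  obtain C where C: "C \<ge> 0" and est: "\<And>s p q \<xi>. p \<ge> 1 \<Longrightarrow> coprime p q \<Longrightarrow> \<bar>of_rat s\<bar> \<le> 1 + \<bar>\<omega>\<bar> \<Longrightarrow>
    \<bar>of_int q / of_int p\<bar> \<le> 1 + \<bar>\<omega>\<bar> \<Longrightarrow>
    \<bar>peierls_rat r S s \<xi> - peierls_pq r S p q \<xi>\<bar> \<le> C * (1 / of_int p + \<bar>of_int p * of_rat s - of_int q\<bar>)"
    using peierls_rat_estimate[OF less_imp_le[OF abs_add_one_gt_zero]] by blast
  have "\<exists>l. ((\<lambda>s. peierls_rat r S s \<xi>) \<longlongrightarrow> l) (filtercomap of_rat (nhds \<omega>))"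
    by (rule rat_filter_convergent, rule rational_comparison_imp_Cauchy[OF irr C _ est])
  then show ?thesis
    using tendsto_Lim[OF rat_filter_neq_bot] irr by (auto simp: peierls_def)
qed

text \<open>The rational estimate passes to the limit. Rationals close to \<omega> may exceed
  \<open>L\<close> in absolute value, hence the constant is taken for \<open>L + 1\<close>.\<close>

lemma peierls_estimate:
  fixes L :: real
  assumes L: "L > 0"
  shows "\<exists>C\<ge>0. \<forall>\<omega> p q \<xi>. p \<ge> 1 \<longrightarrow> coprime p q \<longrightarrow> \<bar>\<omega>\<bar> \<le> L \<longrightarrow> \<bar>of_int q / of_int p\<bar> \<le> L \<longrightarrow>
    \<bar>peierls r S \<omega> \<xi> - peierls_pq r S p q \<xi>\<bar> \<le> C * (1 / of_int p + \<bar>of_int p * \<omega> - of_int q\<bar>)"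
proof -
  have L1: "L + 1 \<ge> 0" using L by simp
  obtain C where C: "C \<ge> 0" and est: "\<And>s p q \<xi>. p \<ge> 1 \<Longrightarrow> coprime p q \<Longrightarrow> \<bar>of_rat s\<bar> \<le> L + 1 \<Longrightarrow>
    \<bar>of_int q / of_int p\<bar> \<le> L + 1 \<Longrightarrow>
    \<bar>peierls_rat r S s \<xi> - peierls_pq r S p q \<xi>\<bar> \<le> C * (1 / of_int p + \<bar>of_int p * of_rat s - of_int q\<bar>)"
    using peierls_rat_estimate[OF L1] by blast
  have "\<bar>peierls r S \<omega> \<xi> - peierls_pq r S p q \<xi>\<bar> \<le> C * (1 / of_int p + \<bar>of_int p * \<omega> - of_int q\<bar>)"
    if pq: "p \<ge> 1" "coprime p q" and \<omega>: "\<bar>\<omega>\<bar> \<le> L" and qp: "\<bar>of_int q / of_int p\<bar> \<le> L" for \<omega> p q \<xi>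
  proof (cases "\<omega> \<in> \<rat>")
    case True
    then obtain s where "\<omega> = of_rat s" by (auto elim: Rats_cases)
    then show ?thesis using est[OF pq, of s \<xi>] \<omega> qp by (simp add: peierls_of_rat)
  next
    case False
    let ?F = "filtercomap of_rat (nhds \<omega>)"
    have "((\<lambda>s. \<bar>peierls_rat r S s \<xi> - peierls_pq r S p q \<xi>\<bar>) \<longlongrightarrow> \<bar>peierls r S \<omega> \<xi> - peierls_pq r S p q \<xi>\<bar>) ?F"
      by (intro tendsto_intros peierls_limit False)
    moreover have "((\<lambda>s. C * (1 / of_int p + \<bar>of_int p * of_rat s - of_int q\<bar>)) \<longlongrightarrow>
        C * (1 / of_int p + \<bar>of_int p * \<omega> - of_int q\<bar>)) ?F"
      by (intro tendsto_intros tendsto_of_rat)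
    moreover have "eventually (\<lambda>s. \<bar>peierls_rat r S s \<xi> - peierls_pq r S p q \<xi>\<bar>
        \<le> C * (1 / of_int p + \<bar>of_int p * of_rat s - of_int q\<bar>)) ?F"
      using tendstoD[OF tendsto_of_rat, of 1 \<omega>]
    proof (rule eventually_mono)
      fix s assume "dist (of_rat s) \<omega> < 1"
      then have "\<bar>of_rat s\<bar> \<le> L + 1" using \<omega> unfolding dist_real_def by linarith
      then show "\<bar>peierls_rat r S s \<xi> - peierls_pq r S p q \<xi>\<bar> \<le> C * (1 / of_int p + \<bar>of_int p * of_rat s - of_int q\<bar>)"
        using est[OF pq] qp by simp
    qed simp
    ultimately show ?thesis by (intro tendsto_le[OF rat_filter_neq_bot])
  qed
  then show ?thesis using C by blast
qed

lemma peierls_isCont: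
  assumes irr: "\<omega> \<notin> \<rat>"
  shows "isCont (\<lambda>\<omega>. peierls r S \<omega> \<xi>) \<omega>"
proof -
  obtain C where C: "C \<ge> 0" and est: "\<And>\<Omega> p q \<xi>. p \<ge> 1 \<Longrightarrow> coprime p q \<Longrightarrow> \<bar>\<Omega>\<bar> \<le> 1 + \<bar>\<omega>\<bar> \<Longrightarrow>
    \<bar>of_int q / of_int p\<bar> \<le> 1 + \<bar>\<omega>\<bar> \<Longrightarrow>
    \<bar>peierls r S \<Omega> \<xi> - peierls_pq r S p q \<xi>\<bar> \<le> C * (1 / of_int p + \<bar>of_int p * \<Omega> - of_int q\<bar>)"
    using peierls_estimate[OF abs_add_one_gt_zero] by blast
  have "\<exists>d>0. \<forall>\<Omega>. dist \<Omega> \<omega> < d \<longrightarrow> dist (peierls r S \<Omega> \<xi>) (peierls r S \<omega> \<xi>) < e" if e: "e > 0" for e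
  proof -
    obtain d where "d > 0" "\<forall>s t. \<bar>s - \<omega>\<bar> < d \<longrightarrow> \<bar>t - \<omega>\<bar> < d \<longrightarrow> \<bar>peierls r S s \<xi> - peierls r S t \<xi>\<bar> < e"
      using rational_comparison_imp_Cauchy[where pos="\<lambda>s. s" and f="\<lambda>s. peierls r S s \<xi>", OF irr C e est] by blast
    then show ?thesis by (intro exI[of _ d]) (simp add: dist_real_def)
  qed
  then show ?thesis unfolding continuous_at_eps_delta by blast
qed

lemma peierls_holder:
  assumes "diophantine \<omega>"
  shows "holder_continuous_at (\<lambda>\<omega>. peierls r S \<omega> \<xi>) \<omega>"
proof -
  obtain C where C: "C \<ge> 0" and est: "\<And>\<Omega> p q \<xi>. p \<ge> 1 \<Longrightarrow> coprime p q \<Longrightarrow> \<bar>\<Omega>\<bar> \<le> 1 + \<bar>\<omega>\<bar> \<Longrightarrow>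
    \<bar>of_int q / of_int p\<bar> \<le> 1 + \<bar>\<omega>\<bar> \<Longrightarrow>
    \<bar>peierls r S \<Omega> \<xi> - peierls_pq r S p q \<xi>\<bar> \<le> C * (1 / of_int p + \<bar>of_int p * \<Omega> - of_int q\<bar>)"
    using peierls_estimate[OF abs_add_one_gt_zero] by blast
  show ?thesis by (rule holder_of_diophantine[OF assms C est])
qed

end

section \<open>From conditions A, B and C to the abstract setting, and the conclusion\<close>

lemma monotone_potentialI:
  assumes loc: "local_potential r S" and A: "cond_A S" and B: "cond_B r S" and C: "cond_C r S"
  shows "monotone_potential r S"
proof
  have C1: "C1_fun r S" using B by (simp add: cond_B_def C2_fun_def)
  show "S (\<lambda>i. x i + of_int m) = S x" for x m by (rule cond_A_int[OF A])
  show "continuous_on UNIV S" using C1 by (simp add: C1_fun_def)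
  show "S (\<lambda>i. min (x i) (y i)) + S (\<lambda>i. max (x i) (y i)) \<le> S x + S y" for x y
    by (rule submodular[OF loc B])
  show "\<exists>K\<ge>0. \<forall>u v. (\<forall>i<r. \<bar>u (Suc i) - u i\<bar> \<le> D) \<longrightarrow> (\<forall>i\<le>r. \<bar>u i - v i\<bar> \<le> D)
      \<longrightarrow> \<bar>S u - S v\<bar> \<le> K * (\<Sum>i\<le>r. \<bar>u i - v i\<bar>)" if "D \<ge> 0" for D
    by (rule lipschitz_bounded_steps[OF loc C1 A that])
  show "\<exists>b. \<forall>x. b \<le> S x" using C by (auto simp: cond_C_def bdd_below_def)
  obtain k where k: "k < r" "filterlim S at_top (filtercomap (\<lambda>x. \<bar>x (k + 1) - x k\<bar>) at_top)"
    using C by (auto simp: cond_C_def)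
  have "\<exists>R. \<forall>x. S x \<le> c \<longrightarrow> \<bar>x (Suc k) - x k\<bar> \<le> R" for c
  proof -
    have "eventually (\<lambda>x. c < S x) (filtercomap (\<lambda>x. \<bar>x (k + 1) - x k\<bar>) at_top)"
      using k(2) by (simp add: filterlim_at_top_dense)
    then obtain Q R where Q: "\<And>x. Q \<bar>x (k + 1) - x k\<bar> \<Longrightarrow> c < S x" and R: "\<And>t. t \<ge> R \<Longrightarrow> Q t"
      by (auto simp: eventually_filtercomap eventually_at_top_linorder)
    have "\<bar>x (Suc k) - x k\<bar> \<le> R" if "S x \<le> c" for x
      using Q[of x, OF R] that by (cases "R \<le> \<bar>x (k + 1) - x k\<bar>") auto
    then show ?thesis by blast
  qed
  then show "\<exists>k<r. \<forall>c. \<exists>R. \<forall>x. S x \<le> c \<longrightarrow> \<bar>x (Suc k) - x k\<bar> \<le> R" using k(1) by blast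
qed

theorem theorem1p1:
  fixes r :: nat and S :: "(nat \<Rightarrow> real) \<Rightarrow> real"
  assumes "r \<ge> 1"
    and "local_potential r S"
    and "cond_A S" and "cond_B r S" and "cond_C r S"
  shows "(\<forall>L>0. \<exists>C. \<forall>\<omega>::real. \<forall>p q :: int.
            p \<ge> 1 \<and> coprime p q \<and> \<bar>\<omega>\<bar> \<le> L \<and> \<bar>of_int q / of_int p\<bar> \<le> L \<longrightarrow>
            (\<forall>\<xi>. \<bar>peierls r S \<omega> \<xi> - peierls r S (of_int q / of_int p) \<xi>\<bar>
                   \<le> C * (1 / \<bar>of_int p\<bar> + \<bar>of_int p * \<omega> - of_int q\<bar>))) \<and>
         (\<forall>\<xi>. (\<forall>\<omega>. \<omega> \<notin> \<rat> \<longrightarrow> isCont (\<lambda>\<omega>. peierls r S \<omega> \<xi>) \<omega>) \<and>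
              (\<forall>\<omega>. diophantine \<omega> \<longrightarrow> holder_continuous_at (\<lambda>\<omega>. peierls r S \<omega> \<xi>) \<omega>))"
proof -
  interpret monotone_potential r S
    by (rule monotone_potentialI[OF assms(2-5)])
  have "\<exists>C. \<forall>\<omega>::real. \<forall>p q :: int.
            p \<ge> 1 \<and> coprime p q \<and> \<bar>\<omega>\<bar> \<le> L \<and> \<bar>of_int q / of_int p\<bar> \<le> L \<longrightarrow>
            (\<forall>\<xi>. \<bar>peierls r S \<omega> \<xi> - peierls r S (of_int q / of_int p) \<xi>\<bar>
                   \<le> C * (1 / \<bar>of_int p\<bar> + \<bar>of_int p * \<omega> - of_int q\<bar>))" if L: "L > 0" for L :: real
  proof -
    obtain C where "\<And>\<omega> p q \<xi>. p \<ge> 1 \<Longrightarrow> coprime p q \<Longrightarrow> \<bar>\<omega>\<bar> \<le> L \<Longrightarrow> \<bar>of_int q / of_int p\<bar> \<le> L \<Longrightarrow>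
      \<bar>peierls r S \<omega> \<xi> - peierls_pq r S p q \<xi>\<bar> \<le> C * (1 / of_int p + \<bar>of_int p * \<omega> - of_int q\<bar>)"
      using peierls_estimate[OF L] by blast
    then show ?thesis by (intro exI[of _ C]) (auto simp: peierls_lowest_terms)
  qed
  then show ?thesis using peierls_isCont peierls_holder by blast
qed

end
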